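(* Let $N\ge2$, $U=-e^{2\pi i/N}\begin{pmatrix}1/2&-\sqrt{3}/2\\ \sqrt3/2&1/2\end{pmatrix}$, and $|\psi_i\rangle=(U^i|0\rangle)^{\otimes N}$ for $i=0,1,2$, each with prior $1/3$, shared among $N$ parties each holding one qubit. Then no $N$-party LOCC measurement attains the optimal minimum-error success probability for this ensemble.
   Context: The optimal minimum-error success probability of an ensemble $\{|\psi_i\rangle,p_i\}_{i=0}^2$ is the maximum over all three-outcome POVMs $\{\Pi_i\}$ on $(\mathbb{C}^2)^{\otimes N}$ of $\sum_ip_i\langle\psi_i|\Pi_i|\psi_i\rangle$. $N$-party LOCC means measurements implementable by local operations on each party's qubit together with classical communication among the parties. *)

theory Defs
  imports "Jordan_Normal_Form.Schur_Decomposition"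
begin

section \<open>N qubits, computational basis indexed by 0..<2^N; bit k of the index is party k's qubit\<close>

definition qbit :: "nat \<Rightarrow> nat \<Rightarrow> nat" where
  "qbit k j = (j div 2 ^ k) mod 2"

definition tensor_pow_vec :: "nat \<Rightarrow> complex vec \<Rightarrow> complex vec" where
  "tensor_pow_vec N v = vec (2 ^ N) (\<lambda>j. \<Prod>k<N. v $ qbit k j)"

definition local_op :: "nat \<Rightarrow> nat \<Rightarrow> complex mat \<Rightarrow> complex mat" where
  "local_op N k A = mat (2 ^ N) (2 ^ N) (\<lambda>(r, c).
     if (\<forall>l<N. l \<noteq> k \<longrightarrow> qbit l r = qbit l c) then A $$ (qbit k r, qbit k c) else 0)"

definition psd :: "nat \<Rightarrow> complex mat \<Rightarrow> bool" where
  "psd d A \<longleftrightarrow> A \<in> carrier_mat d d \<and>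
     (\<forall>x \<in> carrier_vec d. Im (conjugate x \<bullet> (A *\<^sub>v x)) = 0 \<and> Re (conjugate x \<bullet> (A *\<^sub>v x)) \<ge> 0)"

definition is_povm3 :: "nat \<Rightarrow> (nat \<Rightarrow> complex mat) \<Rightarrow> bool" where
  "is_povm3 d P \<longleftrightarrow> (\<forall>i<3. psd d (P i)) \<and> P 0 + P 1 + P 2 = 1\<^sub>m d"

definition success_prob :: "(nat \<Rightarrow> real) \<Rightarrow> (nat \<Rightarrow> complex vec) \<Rightarrow> (nat \<Rightarrow> complex mat) \<Rightarrow> real" where
  "success_prob p \<psi> P = (\<Sum>i<3. p i * Re (conjugate (\<psi> i) \<bullet> (P i *\<^sub>v \<psi> i)))"

definition opt_success :: "nat \<Rightarrow> (nat \<Rightarrow> real) \<Rightarrow> (nat \<Rightarrow> complex vec) \<Rightarrow> real" where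
  "opt_success d p \<psi> = (SUP P \<in> {P. is_povm3 d P}. success_prob p \<psi> P)"

text \<open>A protocol is a finite tree: at a node, party k performs a local measurement with
  2x2 Kraus operators K_m, broadcasts m, and continues with the subprotocol for m.
  A leaf announces the final guess.\<close>
datatype locc = Guess nat | Meas nat "(complex mat \<times> locc) list"

fun locc_valid :: "nat \<Rightarrow> locc \<Rightarrow> bool" where
  "locc_valid N (Guess i) \<longleftrightarrow> i < 3"
| "locc_valid N (Meas k bs) \<longleftrightarrow> k < N \<and> bs \<noteq> [] \<and>
     (\<forall>(K, t) \<in> set bs. K \<in> carrier_mat 2 2 \<and> locc_valid N t) \<and>
     foldr (\<lambda>(K, t) S. mat_adjoint K * K + S) bs (0\<^sub>m 2 2) = 1\<^sub>m 2"

text \<open>The POVM element for final outcome i implemented by the protocol: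
  sum over leaves labelled i of M^H M, where M is the product of the Kraus operators on the path.\<close>
fun locc_povm :: "nat \<Rightarrow> locc \<Rightarrow> nat \<Rightarrow> complex mat" where
  "locc_povm N (Guess j) i = (if j = i then 1\<^sub>m (2 ^ N) else 0\<^sub>m (2 ^ N) (2 ^ N))"
| "locc_povm N (Meas k bs) i =
     foldr (\<lambda>(K, t) S. mat_adjoint (local_op N k K) * locc_povm N t i * local_op N k K + S)
       bs (0\<^sub>m (2 ^ N) (2 ^ N))"

definition is_locc_povm :: "nat \<Rightarrow> (nat \<Rightarrow> complex mat) \<Rightarrow> bool" where
  "is_locc_povm N P \<longleftrightarrow> (\<exists>T. locc_valid N T \<and> (\<forall>i<3. P i = locc_povm N T i))"

definition ket0 :: "complex vec" where
  "ket0 = vec_of_list [1, 0]"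

definition Umat :: "nat \<Rightarrow> complex mat" where
  "Umat N = (- cis (2 * pi / real N)) \<cdot>\<^sub>m
     mat_of_rows_list 2 [[1/2, - of_real (sqrt 3) / 2], [of_real (sqrt 3) / 2, 1/2]]"

definition psi :: "nat \<Rightarrow> nat \<Rightarrow> complex vec" where
  "psi N i = tensor_pow_vec N ((Umat N ^\<^sub>m i) *\<^sub>v ket0)"

end

theory Submission
  imports Defs
begin

text \<open>
  Let \<open>c = (-1/2)^N\<close> be the overlap of any two of the states, let \<open>S\<close> be the square root of their Gram
  matrix (\<open>a + b\<close> on the diagonal, \<open>b\<close> off it), and write \<open>\<psi> i = \<Sum>j. S i j * e j\<close> with \<open>e 0, e 1, e 2\<close>
  orthonormal. The operator \<open>(a + b) S\<close> on their span is a dual certificate for the discrimination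
  problem: the optimum is \<open>(a + b)^2\<close>, it is attained by measuring in the basis \<open>e\<close>, and by
  complementary slackness every optimal POVM satisfies \<open>\<langle>e j|P i|e j\<rangle> = 0\<close> for \<open>j \<noteq> i\<close>, that is, it
  discriminates the \<open>e j\<close> perfectly.

  Along an LOCC protocol with perfect discrimination the three vectors must stay orthogonal. For a
  local operator \<open>E\<close>, orthogonality \<open>\<langle>e i|E|e j\<rangle> = 0\<close> for \<open>i \<noteq> j\<close> means that the matrix
  \<open>\<langle>\<psi> i|E|\<psi> j\<rangle>\<close> equals \<open>S D S\<close> with \<open>D\<close> diagonal, and for trine states this linear system forces \<open>E\<close>
  to be scalar. So the first Kraus operators are multiples of unitaries, which
  preserve this rigidity; by induction over the protocol tree nothing is ever learned.
\<close>

section \<open>Sesquilinear forms of positive operators\<close>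

definition sesq :: "complex mat \<Rightarrow> complex vec \<Rightarrow> complex vec \<Rightarrow> complex" where
  "sesq A x y = conjugate x \<bullet> (A *\<^sub>v y)"

text \<open>Entrywise, with the dimension as an argument: the carrier is then known without
  hypotheses on \<open>f\<close>, and any index type works. Below, combinations are also indexed by
  \<open>bool\<close> and by \<open>unit\<close>.\<close>

definition vcomb :: "nat \<Rightarrow> 'i set \<Rightarrow> ('i \<Rightarrow> complex) \<Rightarrow> ('i \<Rightarrow> complex vec) \<Rightarrow> complex vec" where
  "vcomb n I \<alpha> f = vec n (\<lambda>r. \<Sum>i\<in>I. \<alpha> i * f i $ r)"

lemma vcomb_carrier [simp]: "vcomb n I \<alpha> f \<in> carrier_vec n"
  by (simp add: vcomb_def)

lemma mat_adjoint_alt: "mat_adjoint A = mat (dim_col A) (dim_row A) (\<lambda>(i, j). cnj (A $$ (j, i)))"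
  by (rule eq_matI) (auto simp: mat_adjoint_def mat_of_rows_def)

lemma mat_adjoint_carrier [simp]:
  fixes A :: "complex mat"
  shows "A \<in> carrier_mat m n \<Longrightarrow> mat_adjoint A \<in> carrier_mat n m"
  by (auto simp: mat_adjoint_alt)

lemma sesq_eq_sum:
  assumes "A \<in> carrier_mat n n" "x \<in> carrier_vec n" "y \<in> carrier_vec n"
  shows "sesq A x y = (\<Sum>r<n. \<Sum>c<n. cnj (x $ r) * A $$ (r, c) * y $ c)"
proof -
  have "sesq A x y = (\<Sum>r<n. cnj (x $ r) * (\<Sum>c<n. A $$ (r, c) * y $ c))"
    using assms by (auto simp: sesq_def scalar_prod_def atLeast0LessThan intro!: sum.cong)
  then show ?thesis by (simp add: sum_distrib_left mult.assoc)
qed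

lemma sesq_one:
  assumes "x \<in> carrier_vec n" "y \<in> carrier_vec n"
  shows "sesq (1\<^sub>m n) x y = (\<Sum>r<n. cnj (x $ r) * y $ r)"
  using assms by (auto simp: sesq_def scalar_prod_def atLeast0LessThan intro!: sum.cong)

lemma sesq_one_commute:
  assumes "x \<in> carrier_vec n" "y \<in> carrier_vec n"
  shows "sesq (1\<^sub>m n) y x = cnj (sesq (1\<^sub>m n) x y)"
  using assms by (simp add: sesq_one cnj_sum mult.commute)

lemma sesq_one_self:
  assumes "x \<in> carrier_vec n"
  shows "sesq (1\<^sub>m n) x x = of_real (\<Sum>r<n. (cmod (x $ r))\<^sup>2)"
  unfolding sesq_one[OF assms assms] of_real_sum complex_norm_square by (simp add: mult.commute)

lemma sesq_vcomb:
  assumes A: "A \<in> carrier_mat n n" and "finite I" "finite J"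
    and f: "\<And>i. i \<in> I \<Longrightarrow> f i \<in> carrier_vec n" and g: "\<And>j. j \<in> J \<Longrightarrow> g j \<in> carrier_vec n"
  shows "sesq A (vcomb n I \<alpha> f) (vcomb n J \<beta> g) = (\<Sum>i\<in>I. \<Sum>j\<in>J. cnj (\<alpha> i) * \<beta> j * sesq A (f i) (g j))"
proof -
  have "sesq A (vcomb n I \<alpha> f) (vcomb n J \<beta> g)
      = (\<Sum>r<n. \<Sum>c<n. \<Sum>i\<in>I. \<Sum>j\<in>J. cnj (\<alpha> i) * \<beta> j * (cnj (f i $ r) * A $$ (r, c) * g j $ c))"
    unfolding sesq_eq_sum[OF A vcomb_carrier vcomb_carrier]
    by (intro sum.cong refl)
      (simp add: vcomb_def cnj_sum sum_distrib_left sum_distrib_right mult_ac sum.swap[of _ I J])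
  also have "\<dots> = (\<Sum>i\<in>I. \<Sum>r<n. \<Sum>c<n. \<Sum>j\<in>J. cnj (\<alpha> i) * \<beta> j * (cnj (f i $ r) * A $$ (r, c) * g j $ c))"
    by (subst (2) sum.swap, subst sum.swap) simp
  also have "\<dots> = (\<Sum>i\<in>I. \<Sum>j\<in>J. \<Sum>r<n. \<Sum>c<n. cnj (\<alpha> i) * \<beta> j * (cnj (f i $ r) * A $$ (r, c) * g j $ c))"
    by (intro sum.cong refl, subst (2) sum.swap, subst sum.swap) simp
  also have "\<dots> = (\<Sum>i\<in>I. \<Sum>j\<in>J. cnj (\<alpha> i) * \<beta> j * sesq A (f i) (g j))"
    by (intro sum.cong refl) (simp add: sesq_eq_sum[OF A f g] sum_distrib_left)
  finally show ?thesis .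
qed

lemma sesq_add_mat:
  assumes "A \<in> carrier_mat n n" "B \<in> carrier_mat n n" "x \<in> carrier_vec n" "y \<in> carrier_vec n"
  shows "sesq (A + B) x y = sesq A x y + sesq B x y"
  using assms by (simp add: sesq_eq_sum[where n = n] algebra_simps sum.distrib)

lemma sesq_minus_mat:
  assumes "A \<in> carrier_mat n n" "B \<in> carrier_mat n n" "x \<in> carrier_vec n" "y \<in> carrier_vec n"
  shows "sesq (A - B) x y = sesq A x y - sesq B x y"
proof -
  have "A - B \<in> carrier_mat n n" using assms by auto
  then show ?thesis using assms
    by (simp add: sesq_eq_sum[where n = n] algebra_simps sum_subtractf)
qed

lemma sesq_zero_mat:
  assumes "x \<in> carrier_vec n" "y \<in> carrier_vec n"
  shows "sesq (0\<^sub>m n n) x y = 0"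
  using assms by (simp add: sesq_eq_sum[where n = n])

lemma adjoint_sprod:
  fixes K :: "complex mat"
  assumes "K \<in> carrier_mat m n" "x \<in> carrier_vec n" "z \<in> carrier_vec m"
  shows "conjugate x \<bullet> (mat_adjoint K *\<^sub>v z) = conjugate (K *\<^sub>v x) \<bullet> z"
proof -
  have "conjugate x \<bullet> (mat_adjoint K *\<^sub>v z) = (\<Sum>r<n. \<Sum>c<m. cnj (x $ r) * (cnj (K $$ (c, r)) * z $ c))"
    using assms by (auto simp: mat_adjoint_alt scalar_prod_def atLeast0LessThan sum_distrib_left
        intro!: sum.cong)
  also have "\<dots> = (\<Sum>c<m. \<Sum>r<n. cnj (x $ r) * (cnj (K $$ (c, r)) * z $ c))"
    by (rule sum.swap)
  also have "\<dots> = conjugate (K *\<^sub>v x) \<bullet> z"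
    using assms by (auto simp: scalar_prod_def atLeast0LessThan sum_distrib_left cnj_sum
        mult_ac intro!: sum.cong)
  finally show ?thesis .
qed

lemma sesq_conjugation:
  assumes A: "A \<in> carrier_mat n n" and K: "K \<in> carrier_mat n n" and x: "x \<in> carrier_vec n" and y: "y \<in> carrier_vec n"
  shows "sesq (mat_adjoint K * A * K) x y = sesq A (K *\<^sub>v x) (K *\<^sub>v y)"
proof -
  have "(mat_adjoint K * A * K) *\<^sub>v y = mat_adjoint K *\<^sub>v (A *\<^sub>v (K *\<^sub>v y))"
    using A K y mat_adjoint_carrier[OF K]
    by (simp add: assoc_mult_mat_vec[of _ n n _ n] mult_carrier_mat[of _ n n _ n] mult_mat_vec_carrier[of _ n n])
  then show ?thesis
    unfolding sesq_def using adjoint_sprod[OF K x, of "A *\<^sub>v (K *\<^sub>v y)"] A K y by auto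
qed

lemma psd_sesq:
  assumes "psd n A" "x \<in> carrier_vec n"
  shows "Im (sesq A x x) = 0" "Re (sesq A x x) \<ge> 0"
  using assms by (auto simp: psd_def sesq_def)

lemma psd_carrier: "psd n A \<Longrightarrow> A \<in> carrier_mat n n"
  by (simp add: psd_def)

text \<open>The quadratic form at \<^term>\<open>y + t * x\<close> is affine in \<^term>\<open>t\<close> and its conjugate, so being
  real and nonnegative for all \<^term>\<open>t\<close> forces the linear coefficients to vanish.\<close>

lemma psd_null_vector:
  assumes A: "psd n A" and x: "x \<in> carrier_vec n" and y: "y \<in> carrier_vec n"
    and null: "Re (sesq A x x) = 0"
  shows "sesq A x y = 0" "sesq A y x = 0"
proof -
  have xx: "sesq A x x = 0" using psd_sesq[OF A x] null by (simp add: complex_eq_iff)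
  define u w where "u = sesq A y x" and "w = sesq A x y"
  \<comment> \<open>This is \<open>y + t * x\<close>; the term quadratic in \<open>t\<close> drops
    out because \<open>sesq A x x\<close> vanishes.\<close>
  define z where "z t = vcomb n {False, True} (\<lambda>b. if b then t else 1) (\<lambda>b. if b then x else y)" for t
  have z: "sesq A (z t) (z t) = sesq A y y + t * u + cnj t * w" for t
    unfolding z_def
    by (subst sesq_vcomb[OF psd_carrier[OF A]]) (auto simp: x y xx u_def w_def)
  have im: "Im (t * u + cnj t * w) = 0" for t
    using psd_sesq(1)[OF A, of "z t"] psd_sesq(1)[OF A y] unfolding z by (simp add: z_def)
  have re: "Re (sesq A y y) + Re (t * u + cnj t * w) \<ge> 0" for t
    using psd_sesq(2)[OF A, of "z t"] unfolding z by (simp add: z_def)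
  have lin: "r = 0" if "\<And>s::real. Re (sesq A y y) + s * r \<ge> 0" for r
  proof (rule ccontr)
    assume "r \<noteq> 0"
    \<comment> \<open>At this value of \<open>s\<close> the expression is -1.\<close>
    with that[of "- (Re (sesq A y y) + 1) / r"] show False by simp
  qed
  have "Re u + Re w = 0"
    by (rule lin) (use re[of "of_real _"] in \<open>simp add: algebra_simps\<close>)
  moreover have "Im w - Im u = 0"
    by (rule lin) (use re[of "\<i> * of_real _"] in \<open>simp add: algebra_simps\<close>)
  moreover have "Im u + Im w = 0" "Re u - Re w = 0"
    using im[of 1] im[of \<i>] by simp_all
  ultimately show "sesq A x y = 0" "sesq A y x = 0"
    unfolding u_def[symmetric] w_def[symmetric] by (auto simp: complex_eq_iff)
qed

section \<open>Optimal discrimination of three symmetric vectors\<close>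

lemma lessThan_3: "{..<3::nat} = {0, 1, 2}"
  by auto

lemma less_3_cases: "i < (3::nat) \<Longrightarrow> i = 0 \<or> i = 1 \<or> i = 2"
  by auto

text \<open>Think of \<open>g i j k\<close> as the real part of the (j, k) entry of
  \<open>P i\<close> in the basis \<open>e\<close>. The dual operator (a + b) S minus the projector
  onto \<open>\<psi> i\<close> vanishes in row and column i; on the other two indices it is a times
  the block with diagonal a + 2b and off-diagonal b. The block has eigenvalues a + b and a + 3b, so
  the smaller one times the wrongly assigned diagonal mass still fits under the bound.\<close>

lemma dual_bound_real:
  fixes g :: "nat \<Rightarrow> nat \<Rightarrow> nat \<Rightarrow> real" and a b :: real
  assumes complete: "\<And>j k. j < 3 \<Longrightarrow> k < 3 \<Longrightarrow> g 0 j k + g 1 j k + g 2 j k = (if j = k then 1 else 0)"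
    and pos: "\<And>i j k. i < 3 \<Longrightarrow> j < 3 \<Longrightarrow> k < 3 \<Longrightarrow> \<bar>g i j k + g i k j\<bar> \<le> g i j j + g i k k"
    and a: "a > 0"
  shows "(\<Sum>i<3. \<Sum>j<3. \<Sum>k<3. ((if j = i then a else 0) + b) * ((if k = i then a else 0) + b) * g i j k)
      + a * min (a + b) (a + 3 * b) * (\<Sum>i<3. \<Sum>j<3. if j = i then 0 else g i j j) \<le> 3 * (a + b)\<^sup>2"
proof -
  define \<kappa> where "\<kappa> = min (a + b) (a + 3 * b)"
  \<comment> \<open>This form of the least eigenvalue treats both signs of \<open>b\<close> at
    once.\<close>
  have \<kappa>: "\<kappa> = a + 2 * b - \<bar>b\<bar>" by (auto simp: \<kappa>_def min_def)
  have slack: "a * \<kappa> * (g i j j + g i k k) \<le> a * ((a + 2 * b) * (g i j j + g i k k) + b * (g i j k + g i k j))"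
    if "i < 3" "j < 3" "k < 3" for i j k
  proof -
    have "\<bar>b * (g i j k + g i k j)\<bar> \<le> \<bar>b\<bar> * (g i j j + g i k k)"
      unfolding abs_mult by (intro mult_left_mono pos that) simp
    then have "\<kappa> * (g i j j + g i k k) \<le> (a + 2 * b) * (g i j j + g i k k) + b * (g i j k + g i k j)"
      unfolding \<kappa> by (simp add: algebra_simps)
    with a show ?thesis by (simp add: mult.assoc)
  qed
  \<comment> \<open>The dual operator (a + b) S paired with the sum of the three elements;
    completeness leaves only its trace.\<close>
  define T where "T = (\<Sum>j<3. \<Sum>k<3. (if j = k then (a + b)\<^sup>2 else (a + b) * b) * (g 0 j k + g 1 j k + g 2 j k))"
  have T: "T = 3 * (a + b)\<^sup>2"
  proof -
    have "T = (\<Sum>j<3::nat. \<Sum>k<3::nat. (if j = k then (a + b)\<^sup>2 else (a + b) * b) * (if j = k then 1 else 0))"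
      unfolding T_def by (intro sum.cong refl arg_cong2[where f = "(*)"] complete) simp_all
    then show ?thesis by (simp add: lessThan_3)
  qed
  have "(\<Sum>i<3. \<Sum>j<3. \<Sum>k<3. ((if j = i then a else 0) + b) * ((if k = i then a else 0) + b) * g i j k)
     = T - a * ((a + 2 * b) * (g 0 1 1 + g 0 2 2) + b * (g 0 1 2 + g 0 2 1))
         - a * ((a + 2 * b) * (g 1 0 0 + g 1 2 2) + b * (g 1 0 2 + g 1 2 0))
         - a * ((a + 2 * b) * (g 2 0 0 + g 2 1 1) + b * (g 2 0 1 + g 2 1 0))"
    unfolding T_def by (simp add: lessThan_3 algebra_simps power2_eq_square)
  moreover have "a * \<kappa> * (\<Sum>i<3. \<Sum>j<3. if j = i then 0 else g i j j)
     = a * \<kappa> * (g 0 1 1 + g 0 2 2) + a * \<kappa> * (g 1 0 0 + g 1 2 2) + a * \<kappa> * (g 2 0 0 + g 2 1 1)"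
    by (simp add: lessThan_3 algebra_simps)
  ultimately show ?thesis
    using slack[of 0 1 2] slack[of 1 0 2] slack[of 2 0 1] T unfolding \<kappa>_def by simp
qed

text \<open>The vectors \<open>\<psi> i\<close> are the columns of the square root of their Gram matrix (with diagonal
  entries \<open>a + b\<close> and off-diagonal entries \<open>b\<close>) in the orthonormal basis \<open>e\<close> of their span.\<close>

locale symmetric_triple =
  fixes n :: nat and e \<psi> :: "nat \<Rightarrow> complex vec" and a b :: real
  assumes e_carrier: "i < 3 \<Longrightarrow> e i \<in> carrier_vec n"
    and e_orthonormal: "i < 3 \<Longrightarrow> j < 3 \<Longrightarrow> sesq (1\<^sub>m n) (e i) (e j) = (if i = j then 1 else 0)"
    and psi_eq: "i < 3 \<Longrightarrow> \<psi> i = vcomb n {..<3} (\<lambda>j. of_real ((if j = i then a else 0) + b)) e"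
    and a_pos: "a > 0" and ab_pos: "a + 3 * b > 0" and psi_unit: "(a + b)\<^sup>2 + 2 * b\<^sup>2 = 1"
begin

lemma psi_carrier: "i < 3 \<Longrightarrow> \<psi> i \<in> carrier_vec n"
  by (simp add: psi_eq)

lemma sesq_psi:
  assumes "A \<in> carrier_mat n n" "i < 3" "k < 3"
  shows "sesq A (\<psi> i) (\<psi> k) = (\<Sum>j<3. \<Sum>l<3. of_real ((if j = i then a else 0) + b) *
    of_real ((if l = k then a else 0) + b) * sesq A (e j) (e l))"
  unfolding psi_eq[OF assms(2)] psi_eq[OF assms(3)]
  by (subst sesq_vcomb[OF assms(1)]) (simp_all add: e_carrier)

lemma sesq_psi_e:
  assumes "i < 3" "k < 3"
  shows "sesq (1\<^sub>m n) (e k) (\<psi> i) = of_real ((if k = i then a else 0) + b)"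
proof -
  \<comment> \<open>A one-term combination, so that \<open>sesq_vcomb\<close> applies in both
    arguments.\<close>
  have e: "e k = vcomb n {()} (\<lambda>_. 1) (\<lambda>_. e k)"
    using e_carrier[OF assms(2)] by (auto simp: vcomb_def)
  show ?thesis unfolding psi_eq[OF assms(1)]
    by (subst e, subst sesq_vcomb) (use assms in \<open>simp_all add: e_carrier e_orthonormal if_distrib cong: if_cong\<close>)
qed

definition weight :: "(nat \<Rightarrow> complex mat) \<Rightarrow> real" where
  "weight P = (\<Sum>i<3. Re (sesq (P i) (\<psi> i) (\<psi> i)))"

text \<open>\<open>dual_bound_real\<close> applied to the matrix entries of \<open>P i\<close> in
  the basis \<open>e\<close>. Completeness is phrased through \<open>sesq\<close>, the form in which
  it is proved for protocols by induction.\<close>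

lemma weight_bound:
  assumes psd: "\<And>i. i < 3 \<Longrightarrow> psd n (P i)"
    and complete: "\<And>x y. x \<in> carrier_vec n \<Longrightarrow> y \<in> carrier_vec n \<Longrightarrow>
      sesq (P 0) x y + sesq (P 1) x y + sesq (P 2) x y = sesq (1\<^sub>m n) x y"
  shows "weight P + a * min (a + b) (a + 3 * b) * (\<Sum>i<3. \<Sum>j<3. if j = i then 0 else Re (sesq (P i) (e j) (e j)))
    \<le> 3 * (a + b)\<^sup>2"
proof -
  define g where "g i j k = Re (sesq (P i) (e j) (e k))" for i j k
  have "weight P = (\<Sum>i<3. \<Sum>j<3. \<Sum>k<3. ((if j = i then a else 0) + b) * ((if k = i then a else 0) + b) * g i j k)"
    unfolding weight_def g_def
    by (intro sum.cong refl, subst sesq_psi) (simp_all add: psd psd_carrier flip: of_real_mult)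
  moreover have "g 0 j k + g 1 j k + g 2 j k = (if j = k then 1 else 0)" if "j < 3" "k < 3" for j k
    using arg_cong[OF complete[OF e_carrier[OF that(1)] e_carrier[OF that(2)]], of Re] that
    by (simp add: g_def e_orthonormal)
  moreover have "\<bar>g i j k + g i k j\<bar> \<le> g i j j + g i k k" if "i < 3" "j < 3" "k < 3" for i j k
  proof -
    \<comment> \<open>This is \<open>e j + s * e k\<close>; positivity at s = 1 and s = -1 gives the
      two halves of the absolute value bound.\<close>
    define z where "z s = vcomb n {False, True} (\<lambda>c. of_real (if c then s else 1)) (\<lambda>c. e (if c then k else j))" for s
    have "0 \<le> Re (sesq (P i) (z s) (z s))" for s
      by (rule psd_sesq(2)[OF psd[OF that(1)]]) (simp add: z_def)
    moreover have "Re (sesq (P i) (z s) (z s)) = g i j j + s * (g i j k + g i k j) + s * s * g i k k" for s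
      unfolding z_def using that
      by (subst sesq_vcomb[OF psd_carrier[OF psd]]) (simp_all add: e_carrier g_def algebra_simps)
    ultimately have "0 \<le> g i j j + s * (g i j k + g i k j) + s * s * g i k k" for s
      by metis
    from this[of 1] this[of "-1"] show ?thesis by simp
  qed
  ultimately show ?thesis
    using dual_bound_real[of g a b, OF _ _ a_pos] by (simp only: g_def[symmetric])
qed

lemma weight_le:
  assumes psd: "\<And>i. i < 3 \<Longrightarrow> psd n (P i)"
    and complete: "\<And>x y. x \<in> carrier_vec n \<Longrightarrow> y \<in> carrier_vec n \<Longrightarrow>
      sesq (P 0) x y + sesq (P 1) x y + sesq (P 2) x y = sesq (1\<^sub>m n) x y"
  shows "weight P \<le> 3 * (a + b)\<^sup>2"
proof -
  have "0 \<le> (\<Sum>i<3. \<Sum>j<3. if j = i then 0 else Re (sesq (P i) (e j) (e j)))"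
    by (intro sum_nonneg) (auto intro!: psd_sesq(2)[OF psd] e_carrier)
  moreover have "0 \<le> a * min (a + b) (a + 3 * b)"
    using a_pos ab_pos by (auto simp: min_def)
  ultimately show ?thesis
    using weight_bound[of P] assms by (smt (verit) mult_nonneg_nonneg)
qed

text \<open>Complementary slackness: the penalty in \<open>weight_bound\<close> has a strictly
  positive coefficient and nonnegative summands, so at the optimum each summand is zero.\<close>

lemma optimal_discriminates:
  assumes psd: "\<And>i. i < 3 \<Longrightarrow> psd n (P i)"
    and complete: "\<And>x y. x \<in> carrier_vec n \<Longrightarrow> y \<in> carrier_vec n \<Longrightarrow>
      sesq (P 0) x y + sesq (P 1) x y + sesq (P 2) x y = sesq (1\<^sub>m n) x y"
    and opt: "weight P \<ge> 3 * (a + b)\<^sup>2"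
    and ij: "i < 3" "j < 3" "i \<noteq> j"
  shows "Re (sesq (P i) (e j) (e j)) = 0"
proof -
  let ?h = "\<lambda>i j. if j = i then 0 else Re (sesq (P i) (e j) (e j))"
  have h: "0 \<le> ?h i j" if "i < 3" "j < 3" for i j
    using that by (auto intro!: psd_sesq(2)[OF psd] e_carrier)
  have "0 < a * min (a + b) (a + 3 * b)"
    using a_pos ab_pos by (auto simp: min_def)
  moreover have "a * min (a + b) (a + 3 * b) * (\<Sum>i<3. \<Sum>j<3. ?h i j) \<le> 0"
    using weight_bound[of P] assms by simp
  ultimately have "(\<Sum>i<3. \<Sum>j<3. ?h i j) \<le> 0"
    by (meson mult_pos_pos not_le)
  moreover have "?h i j \<le> (\<Sum>i<3. \<Sum>j<3. ?h i j)"
  proof -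
    have "?h i j \<le> (\<Sum>j<3. ?h i j)"
      by (rule member_le_sum[where f = "?h i"]) (use ij h in auto)
    also have "\<dots> \<le> (\<Sum>i<3. \<Sum>j<3. ?h i j)"
      by (rule member_le_sum[where f = "\<lambda>i. \<Sum>j<3. ?h i j"]) (use ij h in \<open>auto intro!: sum_nonneg\<close>)
    finally show ?thesis .
  qed
  ultimately show ?thesis using h[OF ij(1,2)] ij by simp
qed

section \<open>The square-root measurement and the value it attains\<close>

definition e_proj :: "nat \<Rightarrow> complex mat" where
  "e_proj i = mat n n (\<lambda>(r, c). e i $ r * cnj (e i $ c))"

text \<open>The square-root ("pretty good") measurement, in the basis \<open>e\<close>. Outcome 2
  also absorbs the orthogonal complement of the span, so that the elements sum to the identity on
  the whole space.\<close>

definition pgm :: "nat \<Rightarrow> complex mat" where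
  "pgm i = (if i = 2 then 1\<^sub>m n - (e_proj 0 + e_proj 1) else e_proj i)"

lemma e_proj_carrier [simp]: "e_proj i \<in> carrier_mat n n"
  by (simp add: e_proj_def)

lemma sesq_e_proj:
  assumes "i < 3" "x \<in> carrier_vec n" "y \<in> carrier_vec n"
  shows "sesq (e_proj i) x y = cnj (sesq (1\<^sub>m n) (e i) x) * sesq (1\<^sub>m n) (e i) y"
  using assms e_carrier[OF assms(1)] sesq_eq_sum[OF e_proj_carrier assms(2,3), of i]
  by (simp add: sesq_one cnj_sum e_proj_def sum_product) (simp add: mult_ac)

lemma sesq_pgm_2:
  assumes "x \<in> carrier_vec n"
  shows "sesq (pgm 2) x x = sesq (1\<^sub>m n) x x - of_real ((cmod (sesq (1\<^sub>m n) (e 0) x))\<^sup>2 + (cmod (sesq (1\<^sub>m n) (e 1) x))\<^sup>2)"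
proof -
  have "sesq (pgm 2) x x = sesq (1\<^sub>m n) x x - (sesq (e_proj 0) x x + sesq (e_proj 1) x x)"
    using assms by (simp add: pgm_def sesq_minus_mat[where n = n] sesq_add_mat[where n = n])
  then show ?thesis
    using assms by (simp add: sesq_e_proj complex_norm_square mult.commute del: of_real_power)
qed

lemma pgm_povm: "is_povm3 n pgm"
proof -
  have "psd n (e_proj i)" if "i < 3" for i
    unfolding psd_def sesq_def[symmetric]
    using that by (auto simp: sesq_e_proj)
  moreover have "psd n (pgm 2)"
    unfolding psd_def sesq_def[symmetric]
  proof (intro conjI ballI)
    show "pgm 2 \<in> carrier_mat n n" unfolding pgm_def by (simp add: minus_carrier_mat)
    fix x :: "complex vec" assume x: "x \<in> carrier_vec n"
    define u where "u i = sesq (1\<^sub>m n) (e i) x" for i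
    \<comment> \<open>The component of \<open>x\<close> orthogonal to \<open>e 0\<close> and
      \<open>e 1\<close>; its squared norm is the form of \<open>pgm 2\<close> at \<open>x\<close>,
      as in Bessel's inequality.\<close>
    define y where "y = vcomb n {..<3} (\<lambda>i. if i < 2 then - u i else 1) (\<lambda>i. if i < 2 then e i else x)"
    have [simp]: "sesq (1\<^sub>m n) x (e i) = cnj (u i)" if "i < 3" for i
      unfolding u_def by (rule sesq_one_commute) (simp_all add: e_carrier x that)
    have "sesq (1\<^sub>m n) y y = sesq (1\<^sub>m n) x x - (u 0 * cnj (u 0) + u 1 * cnj (u 1))"
      unfolding y_def
      by (subst sesq_vcomb) (simp_all add: e_carrier x lessThan_3 e_orthonormal flip: u_def)
    then have "sesq (pgm 2) x x = sesq (1\<^sub>m n) y y"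
      unfolding sesq_pgm_2[OF x] by (simp add: u_def complex_norm_square del: of_real_power)
    moreover have "y \<in> carrier_vec n" by (simp add: y_def)
    ultimately show "Im (sesq (pgm 2) x x) = 0" "0 \<le> Re (sesq (pgm 2) x x)"
      by (simp_all add: sesq_one_self sum_nonneg)
  qed
  ultimately have "\<forall>i<3. psd n (pgm i)"
    by (auto dest!: less_3_cases simp: pgm_def)
  moreover have "pgm 0 + pgm 1 + pgm 2 = 1\<^sub>m n"
    by (rule eq_matI) (auto simp: pgm_def e_proj_def)
  ultimately show ?thesis by (simp add: is_povm3_def)
qed

text \<open>Each outcome contributes the square of the diagonal entry a + b of S. For outcome 2 this
  reads 1 - 2b^2, which is (a + b)^2 by normalization.\<close>

lemma weight_pgm: "weight pgm = 3 * (a + b)\<^sup>2"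
proof -
  have "Re (sesq (1\<^sub>m n) (\<psi> 2) (\<psi> 2)) = (a + b)\<^sup>2 + 2 * b\<^sup>2"
    by (subst sesq_psi) (simp_all add: lessThan_3 e_orthonormal power2_eq_square flip: of_real_mult of_real_add)
  moreover have "Re (sesq (pgm i) (\<psi> i) (\<psi> i)) = (a + b)\<^sup>2" if "i < 2" for i
    using that by (simp add: pgm_def sesq_e_proj psi_carrier sesq_psi_e power2_eq_square flip: of_real_mult of_real_add)
  ultimately show ?thesis
    using psi_unit unfolding weight_def
    by (simp add: lessThan_3 sesq_pgm_2 psi_carrier sesq_psi_e power2_eq_square flip: of_real_add)
qed

text \<open>The bound in the direction that the contradiction uses: a measurement reaching the
  supremum has weight at least 3(a + b)^2.\<close>

lemma opt_success_ge: "opt_success n (\<lambda>_. 1/3) \<psi> \<ge> (a + b)\<^sup>2"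
proof -
  have success: "success_prob (\<lambda>_. 1/3) \<psi> P = weight P / 3" for P
    by (simp add: success_prob_def weight_def sesq_def sum_divide_distrib)
  have "weight P \<le> 3 * (a + b)\<^sup>2" if P: "is_povm3 n P" for P
  proof (rule weight_le)
    show "psd n (P i)" if "i < 3" for i
      using P that by (simp add: is_povm3_def)
    then have c: "P i \<in> carrier_mat n n" if "i < 3" for i
      using that by (simp add: psd_carrier)
    show "sesq (P 0) x y + sesq (P 1) x y + sesq (P 2) x y = sesq (1\<^sub>m n) x y"
      if "x \<in> carrier_vec n" "y \<in> carrier_vec n" for x y
    proof -
      have "1\<^sub>m n = P 0 + P 1 + P 2" using P by (simp add: is_povm3_def)
      then show ?thesis using that c[of 0] c[of 1] c[of 2] by (simp add: sesq_add_mat[where n = n])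
    qed
  qed
  \<comment> \<open>A real supremum dominates the members of its set only when the set is bounded
    above; \<open>weight_le\<close> supplies the bound.\<close>
  then have "bdd_above (success_prob (\<lambda>_. 1/3) \<psi> ` {P. is_povm3 n P})"
    unfolding success by (intro bdd_aboveI2[where M = "3 * (a + b)\<^sup>2 / 3"] divide_right_mono) auto
  then have "success_prob (\<lambda>_. 1/3) \<psi> pgm \<le> opt_success n (\<lambda>_. 1/3) \<psi>"
    unfolding opt_success_def by (rule cSUP_upper[rotated]) (simp add: pgm_povm)
  then show ?thesis by (simp add: success weight_pgm)
qed

end

section \<open>Operators acting on one qubit\<close>

text \<open>The basis index with bit \<open>k\<close> overwritten. An operator on qubit
  \<open>k\<close> couples the index \<open>r\<close> exactly to the two indices
  \<open>put_bit k b r\<close> with \<open>b < 2\<close>.\<close>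

definition put_bit :: "nat \<Rightarrow> nat \<Rightarrow> nat \<Rightarrow> nat" where
  "put_bit k b j = (if b = 0 then unset_bit k j else set_bit k j)"

lemma qbit_alt: "qbit k j = of_bool (bit j k)"
  by (simp add: qbit_def bit_iff_odd mod_2_eq_odd)

lemma qbit_less_2 [simp]: "qbit k j < 2"
  by (simp add: qbit_alt)

lemma less_exp_iff_bit: "j < 2 ^ N \<longleftrightarrow> (\<forall>l\<ge>N. \<not> bit (j::nat) l)"
proof -
  have "take_bit N j = j \<longleftrightarrow> (\<forall>l. bit (take_bit N j) l = bit j l)"
    by (metis bit_eqI)
  also have "\<dots> \<longleftrightarrow> (\<forall>l\<ge>N. \<not> bit j l)"
    unfolding bit_take_bit_iff by (meson not_less)
  finally show ?thesis
    by (simp only: take_bit_nat_eq_self_iff)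
qed

lemma bit_put_bit: "bit (put_bit k b j) l \<longleftrightarrow> (if l = k then b \<noteq> 0 else bit j l)"
  by (auto simp: put_bit_def bit_set_bit_iff bit_unset_bit_iff)

lemma qbit_put_bit: "b < 2 \<Longrightarrow> qbit l (put_bit k b j) = (if l = k then b else qbit l j)"
  by (auto simp: qbit_alt bit_put_bit less_2_cases_iff)

lemma put_bit_less: "k < N \<Longrightarrow> j < 2 ^ N \<Longrightarrow> put_bit k b j < 2 ^ N"
  by (auto simp: less_exp_iff_bit bit_put_bit)

lemma put_bit_put_bit: "put_bit k b (put_bit k c j) = put_bit k b j"
  by (rule bit_eqI) (simp add: bit_put_bit)

lemma put_bit_commute: "k \<noteq> l \<Longrightarrow> put_bit k b (put_bit l c j) = put_bit l c (put_bit k b j)"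
  by (rule bit_eqI) (simp add: bit_put_bit)

text \<open>Turns the sparsity condition in \<open>local_op\<close> into an explicit list of
  columns. The bits from \<open>N\<close> upwards agree because both indices are below
  \<open>2 ^ N\<close>.\<close>

lemma agree_iff_put_bit:
  assumes "k < N" "r < 2 ^ N" "c < 2 ^ N"
  shows "(\<forall>l<N. l \<noteq> k \<longrightarrow> qbit l r = qbit l c) \<longleftrightarrow> c = put_bit k (qbit k c) r"
proof
  assume eq: "\<forall>l<N. l \<noteq> k \<longrightarrow> qbit l r = qbit l c"
  show "c = put_bit k (qbit k c) r"
  proof (rule bit_eqI)
    fix l
    show "bit c l = bit (put_bit k (qbit k c) r) l"
    proof (cases "l < N")
      case True
      then show ?thesis using eq by (auto simp: bit_put_bit qbit_alt of_bool_eq_iff)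
    next
      case False
      then show ?thesis using assms less_exp_iff_bit[of c N] less_exp_iff_bit[of r N] by (auto simp: bit_put_bit)
    qed
  qed
next
  assume c: "c = put_bit k (qbit k c) r"
  show "\<forall>l<N. l \<noteq> k \<longrightarrow> qbit l r = qbit l c"
    by (subst c) (simp add: qbit_put_bit)
qed

lemma local_op_carrier [simp]: "local_op N k A \<in> carrier_mat (2 ^ N) (2 ^ N)"
  by (simp add: local_op_def)

lemma local_op_mult_vec_carrier [simp]: "local_op N k A *\<^sub>v x \<in> carrier_vec (2 ^ N)"
  by (rule carrier_vecI) (simp add: local_op_def)

lemma local_op_mult_vec:
  assumes k: "k < N" and x: "x \<in> carrier_vec (2 ^ N)" and r: "r < 2 ^ N"
  shows "(local_op N k A *\<^sub>v x) $ r = (\<Sum>b<2. A $$ (qbit k r, b) * x $ put_bit k b r)"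
proof -
  let ?S = "(\<lambda>b. put_bit k b r) ` {..<2}"
  have "(local_op N k A *\<^sub>v x) $ r
      = (\<Sum>c<2 ^ N. if (\<forall>l<N. l \<noteq> k \<longrightarrow> qbit l r = qbit l c) then A $$ (qbit k r, qbit k c) * x $ c else 0)"
    using x r by (auto simp: local_op_def scalar_prod_def atLeast0LessThan intro!: sum.cong)
  also have "\<dots> = (\<Sum>c\<in>?S. A $$ (qbit k r, qbit k c) * x $ c)"
  proof (rule sum.mono_neutral_cong_right)
    show "?S \<subseteq> {..<2 ^ N}" using put_bit_less[OF k r] by auto
    show "\<forall>c\<in>{..<2 ^ N} - ?S. (if \<forall>l<N. l \<noteq> k \<longrightarrow> qbit l r = qbit l c then A $$ (qbit k r, qbit k c) * x $ c else 0) = 0"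
      using agree_iff_put_bit[OF k r] by (auto simp: image_iff)
    show "(if \<forall>l<N. l \<noteq> k \<longrightarrow> qbit l r = qbit l c then A $$ (qbit k r, qbit k c) * x $ c else 0)
        = A $$ (qbit k r, qbit k c) * x $ c" if "c \<in> ?S" for c
      using that by (auto simp: qbit_put_bit)
  qed auto
  also have "\<dots> = (\<Sum>b<2. A $$ (qbit k r, b) * x $ put_bit k b r)"
  proof (subst sum.reindex)
    show "inj_on (\<lambda>b. put_bit k b r) {..<2}"
      by (rule inj_onI) (metis lessThan_iff qbit_put_bit)
  qed (simp add: qbit_put_bit)
  finally show ?thesis .
qed

lemma local_op_mult:
  assumes k: "k < N" and x: "x \<in> carrier_vec (2 ^ N)" and A: "A \<in> carrier_mat 2 2" and B: "B \<in> carrier_mat 2 2"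
  shows "local_op N k A *\<^sub>v (local_op N k B *\<^sub>v x) = local_op N k (A * B) *\<^sub>v x" (is "?l = ?r")
proof (rule eq_vecI)
  fix r assume "r < dim_vec ?r"
  then have r: "r < 2 ^ N" by (simp add: local_op_def)
  have "?l $ r = (\<Sum>b<2. \<Sum>c<2. A $$ (qbit k r, b) * B $$ (b, c) * x $ put_bit k c r)"
    unfolding local_op_mult_vec[OF k local_op_mult_vec_carrier r]
    by (intro sum.cong refl)
      (simp add: local_op_mult_vec[OF k x] put_bit_less[OF k r] qbit_put_bit put_bit_put_bit sum_distrib_left mult.assoc)
  also have "\<dots> = (\<Sum>c<2. \<Sum>b<2. A $$ (qbit k r, b) * B $$ (b, c) * x $ put_bit k c r)"
    by (rule sum.swap)
  also have "\<dots> = ?r $ r"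
    unfolding local_op_mult_vec[OF k x r] using A B
    by (intro sum.cong refl) (simp add: scalar_prod_def atLeast0LessThan sum_distrib_right)
  finally show "?l $ r = ?r $ r" .
qed (simp add: local_op_def)

lemma local_op_commute:
  assumes k: "k < N" and l: "l < N" and kl: "k \<noteq> l" and x: "x \<in> carrier_vec (2 ^ N)"
  shows "local_op N k A *\<^sub>v (local_op N l B *\<^sub>v x) = local_op N l B *\<^sub>v (local_op N k A *\<^sub>v x)" (is "?l = ?r")
proof (rule eq_vecI)
  fix r assume "r < dim_vec ?r"
  then have r: "r < 2 ^ N" by (simp add: local_op_def)
  have "?l $ r = (\<Sum>b<2. \<Sum>c<2. A $$ (qbit k r, b) * B $$ (qbit l r, c) * x $ put_bit l c (put_bit k b r))"
    unfolding local_op_mult_vec[OF k local_op_mult_vec_carrier r] using kl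
    by (intro sum.cong refl)
      (simp add: local_op_mult_vec[OF l x] put_bit_less[OF k r] qbit_put_bit sum_distrib_left mult.assoc)
  also have "\<dots> = (\<Sum>c<2. \<Sum>b<2. B $$ (qbit l r, c) * A $$ (qbit k r, b) * x $ put_bit k b (put_bit l c r))"
    by (subst sum.swap) (simp add: put_bit_commute[OF kl] mult.commute)
  also have "\<dots> = ?r $ r"
    unfolding local_op_mult_vec[OF l local_op_mult_vec_carrier r] using kl
    by (intro sum.cong refl)
      (simp add: local_op_mult_vec[OF k x] put_bit_less[OF l r] qbit_put_bit sum_distrib_left mult.assoc)
  finally show "?l $ r = ?r $ r" .
qed (simp add: local_op_def)

lemma local_op_adjoint:
  assumes "A \<in> carrier_mat 2 2"
  shows "mat_adjoint (local_op N k A) = local_op N k (mat_adjoint A)"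
  using assms by (intro eq_matI) (auto simp: local_op_def mat_adjoint_alt)

lemma local_op_add:
  assumes "A \<in> carrier_mat 2 2" "B \<in> carrier_mat 2 2"
  shows "local_op N k (A + B) = local_op N k A + local_op N k B"
  using assms by (intro eq_matI) (auto simp: local_op_def)

lemma local_op_scalar:
  assumes k: "k < N" and x: "x \<in> carrier_vec (2 ^ N)"
  shows "local_op N k (c \<cdot>\<^sub>m 1\<^sub>m 2) *\<^sub>v x = c \<cdot>\<^sub>v x" (is "?l = ?r")
proof (rule eq_vecI)
  fix r assume "r < dim_vec ?r"
  then have r: "r < 2 ^ N" using x by auto
  have "put_bit k (qbit k r) r = r"
    by (rule bit_eqI) (auto simp: bit_put_bit qbit_alt)
  moreover have "?l $ r = (\<Sum>b<2. if b = qbit k r then c * x $ put_bit k b r else 0)"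
    unfolding local_op_mult_vec[OF k x r] by (intro sum.cong refl) auto
  ultimately show "?l $ r = ?r $ r" using x r by simp
qed (use x in \<open>simp add: local_op_def\<close>)

lemma local_op_zero: "local_op N k (0\<^sub>m 2 2) = 0\<^sub>m (2 ^ N) (2 ^ N)"
  by (rule eq_matI) (auto simp: local_op_def)

lemma sesq_smult_right:
  assumes "A \<in> carrier_mat n n" "x \<in> carrier_vec n" "y \<in> carrier_vec n"
  shows "sesq A x (c \<cdot>\<^sub>v y) = c * sesq A x y"
  using assms by (simp add: sesq_eq_sum[where n = n] sum_distrib_left mult_ac)

lemma sesq_local_op_same:
  assumes k: "k < N" and x: "x \<in> carrier_vec (2 ^ N)" and y: "y \<in> carrier_vec (2 ^ N)"
    and A: "A \<in> carrier_mat 2 2" and K: "K \<in> carrier_mat 2 2"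
  shows "sesq (local_op N k A) (local_op N k K *\<^sub>v x) (local_op N k K *\<^sub>v y)
    = sesq (local_op N k (mat_adjoint K * A * K)) x y"
proof -
  have "sesq (local_op N k A) (local_op N k K *\<^sub>v x) (local_op N k K *\<^sub>v y)
      = conjugate x \<bullet> (local_op N k (mat_adjoint K) *\<^sub>v (local_op N k A *\<^sub>v (local_op N k K *\<^sub>v y)))"
    unfolding sesq_def local_op_adjoint[OF K, symmetric]
    by (rule adjoint_sprod[OF local_op_carrier x, symmetric]) simp
  also have "local_op N k (mat_adjoint K) *\<^sub>v (local_op N k A *\<^sub>v (local_op N k K *\<^sub>v y))
      = local_op N k (mat_adjoint K * A * K) *\<^sub>v y"
    using A K mat_adjoint_carrier[OF K] mult_carrier_mat[OF A K]
    by (simp add: local_op_mult k y assoc_mult_mat[of _ 2 2 _ 2 _ 2])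
  finally show ?thesis by (simp add: sesq_def)
qed

text \<open>Operators of different parties commute, so the adjoint of \<open>K\<close> meets
  \<open>K\<close> and only the scalar \<open>c\<close> remains.\<close>

lemma sesq_local_op_other:
  assumes k: "k < N" and l: "l < N" "k \<noteq> l" and x: "x \<in> carrier_vec (2 ^ N)" and y: "y \<in> carrier_vec (2 ^ N)"
    and K: "K \<in> carrier_mat 2 2" and KK: "mat_adjoint K * K = c \<cdot>\<^sub>m 1\<^sub>m 2"
  shows "sesq (local_op N l A) (local_op N k K *\<^sub>v x) (local_op N k K *\<^sub>v y) = c * sesq (local_op N l A) x y"
proof -
  have "sesq (local_op N l A) (local_op N k K *\<^sub>v x) (local_op N k K *\<^sub>v y)
      = conjugate x \<bullet> (local_op N k (mat_adjoint K) *\<^sub>v (local_op N l A *\<^sub>v (local_op N k K *\<^sub>v y)))"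
    unfolding sesq_def local_op_adjoint[OF K, symmetric]
    by (rule adjoint_sprod[OF local_op_carrier x, symmetric]) simp
  also have "local_op N k (mat_adjoint K) *\<^sub>v (local_op N l A *\<^sub>v (local_op N k K *\<^sub>v y))
      = local_op N l A *\<^sub>v (c \<cdot>\<^sub>v y)"
    using local_op_commute[OF k l(1) l(2) local_op_mult_vec_carrier]
    by (simp add: local_op_mult[OF k y mat_adjoint_carrier[OF K] K] KK local_op_scalar[OF k y])
  finally show ?thesis using sesq_smult_right[OF local_op_carrier x y] by (simp add: sesq_def)
qed

lemma sesq_one_local_op:
  assumes k: "k < N" and x: "x \<in> carrier_vec (2 ^ N)" and y: "y \<in> carrier_vec (2 ^ N)"
    and K: "K \<in> carrier_mat 2 2"
  shows "sesq (1\<^sub>m (2 ^ N)) (local_op N k K *\<^sub>v x) (local_op N k K *\<^sub>v y) = sesq (local_op N k (mat_adjoint K * K)) x y"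
proof -
  have "sesq (1\<^sub>m (2 ^ N)) (local_op N k K *\<^sub>v x) (local_op N k K *\<^sub>v y)
      = conjugate (local_op N k K *\<^sub>v x) \<bullet> (local_op N k K *\<^sub>v y)"
    by (simp add: sesq_def)
  also have "\<dots> = conjugate x \<bullet> (mat_adjoint (local_op N k K) *\<^sub>v (local_op N k K *\<^sub>v y))"
    by (rule adjoint_sprod[OF local_op_carrier x, symmetric]) simp
  also have "\<dots> = sesq (local_op N k (mat_adjoint K * K)) x y"
    by (simp add: sesq_def local_op_adjoint[OF K] local_op_mult[OF k y mat_adjoint_carrier[OF K] K])
  finally show ?thesis .
qed

text \<open>\<open>K\<close> is invertible with inverse its adjoint divided by \<open>c\<close>, so
  the conjugation can be undone, and conjugating a scalar gives a scalar.\<close>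

lemma unitary_multiple_conjugation:
  fixes K E :: "complex mat"
  assumes K: "K \<in> carrier_mat 2 2" and E: "E \<in> carrier_mat 2 2"
    and KK: "mat_adjoint K * K = c \<cdot>\<^sub>m 1\<^sub>m 2" and c: "c \<noteq> 0"
    and KEK: "mat_adjoint K * E * K = d \<cdot>\<^sub>m 1\<^sub>m 2"
  shows "E = (d / c) \<cdot>\<^sub>m 1\<^sub>m 2"
proof -
  define L where "L = (1 / c) \<cdot>\<^sub>m mat_adjoint K"
  have L: "L \<in> carrier_mat 2 2" using mat_adjoint_carrier[OF K] by (simp add: L_def)
  have LK: "L * K = 1\<^sub>m 2"
    using KK c mat_adjoint_carrier[OF K] K by (simp add: L_def mult_smult_assoc_mat[of _ 2 2 _ 2]) (auto intro!: eq_matI)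
  then have KL: "K * L = 1\<^sub>m 2"
    using mat_mult_left_right_inverse[OF L K] by simp
  have "L * E * K = (1 / c) \<cdot>\<^sub>m (mat_adjoint K * E * K)"
    using mult_smult_assoc_mat[OF mat_adjoint_carrier[OF K] E, of "1 / c"]
      mult_smult_assoc_mat[OF mult_carrier_mat[OF mat_adjoint_carrier[OF K] E] K, of "1 / c"]
    by (simp add: L_def)
  then have LEK: "L * E * K = (d / c) \<cdot>\<^sub>m 1\<^sub>m 2"
    unfolding KEK by (auto intro!: eq_matI)
  have "E = K * L * E * (K * L)" using KL E by simp
  also have "\<dots> = K * (L * E * K) * L"
    using K L E by (simp add: assoc_mult_mat[of _ 2 2 _ 2 _ 2])
  also have "\<dots> = (d / c) \<cdot>\<^sub>m (K * L)"
    using K L by (simp add: LEK mult_smult_assoc_mat[of _ 2 2 _ 2] mult_smult_distrib[of _ 2 2 _ 2])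
  finally show ?thesis by (simp add: KL)
qed

section \<open>Perfect discrimination by LOCC\<close>

text \<open>The recursion of \<open>locc\<close> passes through a list of pairs; this rule states
  the induction hypothesis directly for the branches of a node.\<close>

lemma locc_induct [case_names Guess Meas]:
  assumes "\<And>i. P (Guess i)"
    and "\<And>k bs. (\<And>K t. (K, t) \<in> set bs \<Longrightarrow> P t) \<Longrightarrow> P (Meas k bs)"
  shows "P T"
proof (induction T)
  case (Meas k bs)
  show ?case by (rule assms(2)) (use Meas in force)
qed (rule assms(1))

section \<open>POVMs of protocols as sums over branches\<close>

lemma locc_povm_carrier [simp]: "locc_povm N T i \<in> carrier_mat (2 ^ N) (2 ^ N)"
proof (induction T rule: locc_induct)
  case (Meas k bs)
  have "foldr (\<lambda>(K, t) S. mat_adjoint (local_op N k K) * locc_povm N t i * local_op N k K + S) bs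
      (0\<^sub>m (2 ^ N) (2 ^ N)) \<in> carrier_mat (2 ^ N) (2 ^ N)"
    using Meas
  proof (induction bs)
    case (Cons b bs)
    obtain K t where b: "b = (K, t)" by fastforce
    have "locc_povm N t i \<in> carrier_mat (2 ^ N) (2 ^ N)" by (rule Cons.prems[of K]) (simp add: b)
    then have "mat_adjoint (local_op N k K) * locc_povm N t i * local_op N k K \<in> carrier_mat (2 ^ N) (2 ^ N)"
      by (intro mult_carrier_mat[of _ "2 ^ N" "2 ^ N"]) simp_all
    moreover have "foldr (\<lambda>(K, t) S. mat_adjoint (local_op N k K) * locc_povm N t i * local_op N k K + S) bs
      (0\<^sub>m (2 ^ N) (2 ^ N)) \<in> carrier_mat (2 ^ N) (2 ^ N)"
      by (rule Cons.IH) (use Cons.prems in auto)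
    ultimately show ?case by (simp add: b)
  qed simp
  then show ?case by simp
qed simp

lemma foldr_add_carrier:
  assumes "\<And>b. b \<in> set bs \<Longrightarrow> f b \<in> carrier_mat n n"
  shows "foldr (\<lambda>b S. f b + S) bs (0\<^sub>m n n) \<in> carrier_mat n n"
  using assms by (induction bs) auto

lemma sesq_foldr_add:
  assumes x: "x \<in> carrier_vec n" and y: "y \<in> carrier_vec n"
    and "\<And>b. b \<in> set bs \<Longrightarrow> f b \<in> carrier_mat n n"
  shows "sesq (foldr (\<lambda>b S. f b + S) bs (0\<^sub>m n n)) x y = (\<Sum>b\<leftarrow>bs. sesq (f b) x y)"
  using assms(3)
proof (induction bs)
  case (Cons b bs)
  then show ?case
    using sesq_add_mat[OF _ foldr_add_carrier[of bs f n] x y, of "f b"] by simp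
qed (simp add: sesq_zero_mat[OF x y])

text \<open>The recursion step of all later inductions: the Kraus operators move from the POVM
  element onto the vectors, and each subprotocol acts on the post-measurement vectors, which stay
  unnormalized.\<close>

lemma sesq_locc_povm_Meas:
  assumes x: "x \<in> carrier_vec (2 ^ N)" and y: "y \<in> carrier_vec (2 ^ N)"
  shows "sesq (locc_povm N (Meas k bs) i) x y
    = (\<Sum>(K, t)\<leftarrow>bs. sesq (locc_povm N t i) (local_op N k K *\<^sub>v x) (local_op N k K *\<^sub>v y))"
proof -
  define f where "f = (\<lambda>(K, t). mat_adjoint (local_op N k K) * locc_povm N t i * local_op N k K)"
  have f: "f b \<in> carrier_mat (2 ^ N) (2 ^ N)" for b
    unfolding f_def by (auto split: prod.split intro!: mult_carrier_mat[of _ "2 ^ N" "2 ^ N"])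
  have "locc_povm N (Meas k bs) i = foldr (\<lambda>b S. f b + S) bs (0\<^sub>m (2 ^ N) (2 ^ N))"
    by (simp add: f_def case_prod_unfold)
  then have "sesq (locc_povm N (Meas k bs) i) x y = (\<Sum>b\<leftarrow>bs. sesq (f b) x y)"
    using sesq_foldr_add[OF x y f] by simp
  also have "(\<lambda>b. sesq (f b) x y) = (\<lambda>(K, t). sesq (locc_povm N t i) (local_op N k K *\<^sub>v x) (local_op N k K *\<^sub>v y))"
    by (auto simp: f_def sesq_conjugation[OF locc_povm_carrier local_op_carrier x y])
  finally show ?thesis .
qed

lemma local_op_foldr_add:
  assumes "\<And>b. b \<in> set bs \<Longrightarrow> f b \<in> carrier_mat 2 2"
  shows "local_op N k (foldr (\<lambda>b S. f b + S) bs (0\<^sub>m 2 2))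
    = foldr (\<lambda>b S. local_op N k (f b) + S) bs (0\<^sub>m (2 ^ N) (2 ^ N))"
  using assms
proof (induction bs)
  case (Cons b bs)
  then show ?case using local_op_add[OF _ foldr_add_carrier[of bs f 2], of "f b"] by simp
qed (simp add: local_op_zero)

lemma kraus_complete:
  assumes valid: "locc_valid N (Meas k bs)" and x: "x \<in> carrier_vec (2 ^ N)" and y: "y \<in> carrier_vec (2 ^ N)"
  shows "(\<Sum>(K, t)\<leftarrow>bs. sesq (1\<^sub>m (2 ^ N)) (local_op N k K *\<^sub>v x) (local_op N k K *\<^sub>v y)) = sesq (1\<^sub>m (2 ^ N)) x y"
proof -
  have k: "k < N" and K: "\<And>K t. (K, t) \<in> set bs \<Longrightarrow> K \<in> carrier_mat 2 2"
    using valid by auto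
  define f where "f = (\<lambda>(K :: complex mat, t :: locc). mat_adjoint K * K)"
  have f: "f b \<in> carrier_mat 2 2" if "b \<in> set bs" for b
    unfolding f_def using K that by (auto split: prod.split intro!: mult_carrier_mat[of _ 2 2])
  have sum: "foldr (\<lambda>b S. f b + S) bs (0\<^sub>m 2 2) = 1\<^sub>m 2"
    using valid by (simp add: f_def case_prod_unfold)
  have "(\<Sum>(K, t)\<leftarrow>bs. sesq (1\<^sub>m (2 ^ N)) (local_op N k K *\<^sub>v x) (local_op N k K *\<^sub>v y))
      = (\<Sum>b\<leftarrow>bs. sesq (local_op N k (f b)) x y)"
    by (intro arg_cong[where f = sum_list] map_cong refl)
      (auto simp: f_def sesq_one_local_op[OF k x y K])
  also have "\<dots> = sesq (local_op N k (foldr (\<lambda>b S. f b + S) bs (0\<^sub>m 2 2))) x y"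
    by (subst local_op_foldr_add[OF f], assumption)
      (rule sesq_foldr_add[OF x y local_op_carrier, symmetric])
  also have "\<dots> = sesq (1\<^sub>m (2 ^ N)) x y"
  proof -
    have "(1 :: complex) \<cdot>\<^sub>m 1\<^sub>m 2 = 1\<^sub>m 2" by (rule eq_matI) auto
    then have "local_op N k (1\<^sub>m 2) *\<^sub>v y = y"
      using local_op_scalar[OF k y, of 1] by simp
    then show ?thesis using y by (simp add: sum sesq_def)
  qed
  finally show ?thesis .
qed

lemma Re_sum_list: "Re (sum_list (map f xs)) = (\<Sum>x\<leftarrow>xs. Re (f x))"
  by (induction xs) auto

lemma Im_sum_list: "Im (sum_list (map f xs)) = (\<Sum>x\<leftarrow>xs. Im (f x))"
  by (induction xs) auto

lemma sum_list_zero: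
  fixes f :: "'a \<Rightarrow> 'b :: comm_monoid_add"
  shows "(\<And>x. x \<in> set xs \<Longrightarrow> f x = 0) \<Longrightarrow> sum_list (map f xs) = 0"
  by (induction xs) auto

lemma locc_povm_psd: "psd (2 ^ N) (locc_povm N T i)"
proof (induction T rule: locc_induct)
  case (Guess j)
  show ?case unfolding psd_def sesq_def[symmetric]
    by (auto simp: sesq_one_self sesq_zero_mat sum_nonneg simp del: of_real_sum)
next
  case (Meas k bs)
  show ?case unfolding psd_def sesq_def[symmetric]
  proof (intro conjI ballI locc_povm_carrier)
    fix x :: "complex vec" assume x: "x \<in> carrier_vec (2 ^ N)"
    show "Im (sesq (locc_povm N (Meas k bs) i) x x) = 0"
      unfolding sesq_locc_povm_Meas[OF x x] Im_sum_list
      by (rule sum_list_zero) (auto intro!: psd_sesq(1) Meas)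
    show "0 \<le> Re (sesq (locc_povm N (Meas k bs) i) x x)"
      unfolding sesq_locc_povm_Meas[OF x x] Re_sum_list
      by (rule sum_list_nonneg) (auto intro!: psd_sesq(2) Meas)
  qed
qed

lemma locc_povm_complete:
  assumes "locc_valid N T" "x \<in> carrier_vec (2 ^ N)" "y \<in> carrier_vec (2 ^ N)"
  shows "sesq (locc_povm N T 0) x y + sesq (locc_povm N T 1) x y + sesq (locc_povm N T 2) x y
    = sesq (1\<^sub>m (2 ^ N)) x y"
  using assms
proof (induction T arbitrary: x y rule: locc_induct)
  case (Guess j)
  then show ?case by (auto dest!: less_3_cases simp: sesq_zero_mat)
next
  case (Meas k bs)
  note xy = Meas.prems(2,3)
  have "sesq (locc_povm N t 0) (local_op N k K *\<^sub>v x) (local_op N k K *\<^sub>v y)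
      + sesq (locc_povm N t 1) (local_op N k K *\<^sub>v x) (local_op N k K *\<^sub>v y)
      + sesq (locc_povm N t 2) (local_op N k K *\<^sub>v x) (local_op N k K *\<^sub>v y)
      = sesq (1\<^sub>m (2 ^ N)) (local_op N k K *\<^sub>v x) (local_op N k K *\<^sub>v y)" if "(K, t) \<in> set bs" for K t
    using Meas.prems(1) that by (intro Meas.IH[of K]) auto
  then show ?case
    unfolding sesq_locc_povm_Meas[OF xy] kraus_complete[OF Meas.prems, symmetric] sum_list_addf[symmetric]
    by (intro arg_cong[where f = sum_list] map_cong refl) auto
qed

text \<open>Every outcome \<open>m\<close> differs from \<open>i\<close> or from \<open>j\<close>,
  so one of the two vectors is a null vector of \<open>P m\<close> and the cross term vanishes.
  Summing over \<open>m\<close> gives the inner product.\<close>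

lemma perfect_discrimination_orthogonal:
  fixes P :: "nat \<Rightarrow> complex mat"
  assumes psd: "\<And>i. i < 3 \<Longrightarrow> psd n (P i)"
    and complete: "\<And>x y. x \<in> carrier_vec n \<Longrightarrow> y \<in> carrier_vec n \<Longrightarrow>
      sesq (P 0) x y + sesq (P 1) x y + sesq (P 2) x y = sesq (1\<^sub>m n) x y"
    and x: "\<And>j. j < 3 \<Longrightarrow> x j \<in> carrier_vec n"
    and perfect: "\<And>i j. i < 3 \<Longrightarrow> j < 3 \<Longrightarrow> i \<noteq> j \<Longrightarrow> Re (sesq (P i) (x j) (x j)) = 0"
    and ij: "i < 3" "j < 3" "i \<noteq> j"
  shows "sesq (1\<^sub>m n) (x i) (x j) = 0"
proof -
  have "sesq (P m) (x i) (x j) = 0" if m: "m < 3" for m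
  proof (cases "m = j")
    case True
    then show ?thesis
      using psd_null_vector(1)[OF psd x x perfect, of m i j] ij by simp
  next
    case False
    then show ?thesis
      using psd_null_vector(2)[OF psd x x perfect, of m j i] ij m by simp
  qed
  then show ?thesis using complete[OF x x, OF ij(1,2)] by simp
qed

text \<open>No party can start a nontrivial local measurement that keeps the three vectors orthogonal.\<close>

definition locally_rigid :: "nat \<Rightarrow> (nat \<Rightarrow> complex vec) \<Rightarrow> bool" where
  "locally_rigid N x \<longleftrightarrow> (\<forall>k<N. \<forall>E\<in>carrier_mat 2 2.
     (\<forall>i<3. \<forall>j<3. i \<noteq> j \<longrightarrow> sesq (local_op N k E) (x i) (x j) = 0) \<longrightarrow> (\<exists>c. E = c \<cdot>\<^sub>m 1\<^sub>m 2))"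

text \<open>For the party that has just measured, the test operator is replaced by its conjugate
  under \<open>K\<close>; for any other party, the orthogonality conditions change only by the
  nonzero factor \<open>c\<close>.\<close>

lemma locally_rigid_local_unitary:
  assumes rigid: "locally_rigid N x" and x: "\<And>j. j < 3 \<Longrightarrow> x j \<in> carrier_vec (2 ^ N)"
    and k: "k < N" and K: "K \<in> carrier_mat 2 2" and KK: "mat_adjoint K * K = c \<cdot>\<^sub>m 1\<^sub>m 2" and c: "c \<noteq> 0"
  shows "locally_rigid N (\<lambda>j. local_op N k K *\<^sub>v x j)"
  unfolding locally_rigid_def
proof (intro allI ballI impI)
  fix l E assume l: "l < N" and E: "E \<in> carrier_mat 2 2"
    and orth: "\<forall>i<3. \<forall>j<3. i \<noteq> j \<longrightarrow> sesq (local_op N l E) (local_op N k K *\<^sub>v x i) (local_op N k K *\<^sub>v x j) = 0"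
  show "\<exists>c. E = c \<cdot>\<^sub>m 1\<^sub>m 2"
  proof (cases "k = l")
    case True
    have KEK: "mat_adjoint K * E * K \<in> carrier_mat 2 2"
      using K E by (intro mult_carrier_mat[of _ 2 2]) simp_all
    have "sesq (local_op N k (mat_adjoint K * E * K)) (x i) (x j) = 0" if "i < 3" "j < 3" "i \<noteq> j" for i j
      using orth that sesq_local_op_same[OF k x x E K] True by simp
    then obtain d where "mat_adjoint K * E * K = d \<cdot>\<^sub>m 1\<^sub>m 2"
      using rigid KEK k unfolding locally_rigid_def by blast
    then show ?thesis using unitary_multiple_conjugation[OF K E KK c] by blast
  next
    case False
    have "sesq (local_op N l E) (x i) (x j) = 0" if "i < 3" "j < 3" "i \<noteq> j" for i j
      using orth that sesq_local_op_other[OF k l False x x K KK] c by simp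
    then show ?thesis using rigid E l unfolding locally_rigid_def by blast
  qed
qed

text \<open>Suppose that no error occurs. Then every branch is error-free, so its vectors stay
  orthogonal and rigidity makes each Kraus operator a multiple of a unitary. A branch with nonzero
  multiple has vectors that are again rigid and nonzero, contradicting the induction
  hypothesis.\<close>

lemma locally_rigid_not_locc_discriminable:
  assumes "locc_valid N T" "locally_rigid N x"
    and "\<And>j. j < 3 \<Longrightarrow> x j \<in> carrier_vec (2 ^ N)" "\<And>j. j < 3 \<Longrightarrow> sesq (1\<^sub>m (2 ^ N)) (x j) (x j) \<noteq> 0"
  shows "\<exists>i<3. \<exists>j<3. i \<noteq> j \<and> Re (sesq (locc_povm N T i) (x j) (x j)) \<noteq> 0"
  using assms
proof (induction T arbitrary: x rule: locc_induct)
  case (Guess m)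
  \<comment> \<open>A leaf guesses \<open>m\<close> whatever the input, so any other vector is
    misidentified.\<close>
  obtain j :: nat where j: "j < 3" "j \<noteq> m"
    by (metis less_numeral_extra(1) one_less_numeral_iff semiring_norm(77) zero_less_numeral zero_neq_one)
  have "Re (sesq (1\<^sub>m (2 ^ N)) (x j) (x j)) \<noteq> 0"
    using Guess.prems(4)[OF j(1)] unfolding sesq_one_self[OF Guess.prems(3)[OF j(1)]] by (metis Re_complex_of_real of_real_0)
  then show ?case using Guess.prems(1) j by (intro exI[of _ m] exI[of _ j]) auto
next
  case (Meas k bs)
  note x = Meas.prems(3)
  have k: "k < N" and valid: "\<And>K t. (K, t) \<in> set bs \<Longrightarrow> locc_valid N t"
    and K: "\<And>K t. (K, t) \<in> set bs \<Longrightarrow> K \<in> carrier_mat 2 2"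
    using Meas.prems(1) by auto
  show ?case
  proof (rule ccontr)
    assume "\<not> ?thesis"
    then have zero: "Re (sesq (locc_povm N (Meas k bs) i) (x j) (x j)) = 0" if "i < 3" "j < 3" "i \<noteq> j" for i j
      using that by blast
    have branch: "Re (sesq (locc_povm N t i) (local_op N k K *\<^sub>v x j) (local_op N k K *\<^sub>v x j)) = 0"
      if "i < 3" "j < 3" "i \<noteq> j" "(K, t) \<in> set bs" for i j K t
    proof -
      let ?h = "\<lambda>b. Re (case b of (K, t) \<Rightarrow> sesq (locc_povm N t i) (local_op N k K *\<^sub>v x j) (local_op N k K *\<^sub>v x j))"
      \<comment> \<open>The error probability is a sum of nonnegative contributions of the branches,
        so each of them is zero.\<close>
      have "sum_list (map ?h bs) = 0"
        using zero[OF that(1-3)] unfolding sesq_locc_povm_Meas[OF x x, OF that(2,2)] Re_sum_list .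
      moreover have "\<forall>b\<in>set (map ?h bs). 0 \<le> b"
        by (auto intro!: psd_sesq(2)[OF locc_povm_psd])
      ultimately have "\<forall>b\<in>set (map ?h bs). b = 0"
        using sum_list_nonneg_eq_0_iff[of "map ?h bs"] by blast
      then show ?thesis using that(4) by force
    qed
    have scalar: "\<exists>c. mat_adjoint K * K = c \<cdot>\<^sub>m 1\<^sub>m 2" if b: "(K, t) \<in> set bs" for K t
    proof -
      have "sesq (local_op N k (mat_adjoint K * K)) (x i) (x j) = 0" if ij: "i < 3" "j < 3" "i \<noteq> j" for i j
        unfolding sesq_one_local_op[OF k x x K[OF b], OF ij(1,2), symmetric]
        by (rule perfect_discrimination_orthogonal[where P = "locc_povm N t" and x = "\<lambda>j. local_op N k K *\<^sub>v x j"])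
          (use b ij branch locc_povm_complete[OF valid[OF b]] in \<open>simp_all add: locc_povm_psd\<close>)
      moreover have "mat_adjoint K * K \<in> carrier_mat 2 2"
        using K[OF b] by (intro mult_carrier_mat[of _ 2 2]) simp_all
      ultimately show ?thesis
        using Meas.prems(2) k unfolding locally_rigid_def by blast
    qed
    have norm: "sesq (1\<^sub>m (2 ^ N)) (local_op N k K *\<^sub>v x j) (local_op N k K *\<^sub>v x j) = c * sesq (1\<^sub>m (2 ^ N)) (x j) (x j)"
      if "(K, t) \<in> set bs" "mat_adjoint K * K = c \<cdot>\<^sub>m 1\<^sub>m 2" "j < 3" for K t c j
      unfolding sesq_one_local_op[OF k x x K[OF that(1)], OF that(3,3)] that(2)
      using local_op_scalar[OF k x[OF that(3)], of c] sesq_smult_right[OF one_carrier_mat x x, OF that(3,3)] x[OF that(3)]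
      by (simp add: sesq_def)
    \<comment> \<open>If all multiples were zero, every branch would annihilate \<open>x 0\<close>,
      against completeness of the Kraus operators.\<close>
    have "\<exists>(K, t)\<in>set bs. \<exists>c. c \<noteq> 0 \<and> mat_adjoint K * K = c \<cdot>\<^sub>m 1\<^sub>m 2"
    proof (rule ccontr)
      assume none: "\<not> ?thesis"
      have "(case b of (K, t) \<Rightarrow> sesq (1\<^sub>m (2 ^ N)) (local_op N k K *\<^sub>v x 0) (local_op N k K *\<^sub>v x 0)) = 0"
        if b: "b \<in> set bs" for b
      proof -
        obtain K t where Kt: "b = (K, t)" by fastforce
        then obtain c where c: "mat_adjoint K * K = c \<cdot>\<^sub>m 1\<^sub>m 2" using scalar[of K t] b by blast
        then have "c = 0" using none b Kt by blast
        then show ?thesis using norm[OF _ c, of t 0] b Kt by simp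
      qed
      then have "(\<Sum>(K, t)\<leftarrow>bs. sesq (1\<^sub>m (2 ^ N)) (local_op N k K *\<^sub>v x 0) (local_op N k K *\<^sub>v x 0)) = 0"
        by (rule sum_list_zero)
      then have "sesq (1\<^sub>m (2 ^ N)) (x 0) (x 0) = 0"
        using kraus_complete[OF Meas.prems(1) x x, of 0 0] by simp
      then show False using Meas.prems(4)[of 0] by simp
    qed
    then obtain K t c where b: "(K, t) \<in> set bs" and c: "c \<noteq> 0" and KK: "mat_adjoint K * K = c \<cdot>\<^sub>m 1\<^sub>m 2"
      by blast
    have "\<exists>i<3. \<exists>j<3. i \<noteq> j \<and> Re (sesq (locc_povm N t i) (local_op N k K *\<^sub>v x j) (local_op N k K *\<^sub>v x j)) \<noteq> 0"
    proof (rule Meas.IH[OF b valid[OF b]])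
      show "locally_rigid N (\<lambda>j. local_op N k K *\<^sub>v x j)"
        by (rule locally_rigid_local_unitary[OF Meas.prems(2) x k K[OF b] KK c])
    qed (use norm[OF b KK] c Meas.prems(4) in simp_all)
    then show False using branch[OF _ _ _ b] by blast
  qed
qed

section \<open>Trine states\<close>

text \<open>Distributivity over bit strings; the induction splits the indices by their top
  bit.\<close>

lemma sum_prod_qbit:
  fixes g :: "nat \<Rightarrow> nat \<Rightarrow> complex"
  shows "(\<Sum>j<2 ^ N. \<Prod>l<N. g l (qbit l j)) = (\<Prod>l<N. g l 0 + g l 1)"
proof (induction N)
  case (Suc N)
  have low: "qbit N j = 0" if "j < 2 ^ N" for j
    using that by (simp add: qbit_def)
  have high: "qbit N (j + 2 ^ N) = 1" if "j < 2 ^ N" for j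
    using that by (simp add: qbit_def)
  have shift: "qbit l (j + 2 ^ N) = qbit l j" if l: "l < N" for l j
  proof -
    obtain m where m: "N = Suc (l + m)" using less_imp_Suc_add[OF l] by blast
    \<comment> \<open>An even multiple of \<open>2 ^ l\<close>: adding it changes the quotient by an
      even number and leaves bit \<open>l\<close> alone.\<close>
    have "2 ^ N = (2 * 2 ^ m) * (2 :: nat) ^ l" by (simp add: m power_add)
    then have "(j + 2 ^ N) div 2 ^ l = 2 * 2 ^ m + j div 2 ^ l"
      by (simp only: div_mult_self1[OF power_not_zero[OF zero_neq_numeral[symmetric]]])
    then show ?thesis by (simp add: qbit_def)
  qed
  have "(\<Sum>j<2 ^ Suc N. \<Prod>l<Suc N. g l (qbit l j))
      = (\<Sum>j<2 ^ N. \<Prod>l<Suc N. g l (qbit l j)) + (\<Sum>j<2 ^ N. \<Prod>l<Suc N. g l (qbit l (j + 2 ^ N)))"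
  proof -
    have "{..<2 ^ Suc N} = {..<2 ^ N} \<union> (\<lambda>j. j + 2 ^ N) ` {..<2 ^ N::nat}"
    proof (intro equalityI subsetI)
      fix j :: nat assume "j \<in> {..<2 ^ Suc N}"
      then show "j \<in> {..<2 ^ N} \<union> (\<lambda>j. j + 2 ^ N) ` {..<2 ^ N}"
        by (cases "j < 2 ^ N") (auto intro!: image_eqI[of _ _ "j - 2 ^ N"])
    qed auto
    moreover have "{..<2 ^ N} \<inter> (\<lambda>j. j + 2 ^ N) ` {..<2 ^ N::nat} = {}" by auto
    ultimately show ?thesis
      by (simp only: sum.union_disjoint finite_lessThan finite_imageI) (simp add: sum.reindex)
  qed
  also have "\<dots> = (\<Sum>j<2 ^ N. (\<Prod>l<N. g l (qbit l j)) * g N 0) + (\<Sum>j<2 ^ N. (\<Prod>l<N. g l (qbit l j)) * g N 1)"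
    by (intro arg_cong2[where f = "(+)"] sum.cong refl) (simp_all add: low high shift)
  also have "\<dots> = (\<Prod>l<Suc N. g l 0 + g l 1)"
    by (simp add: Suc.IH distrib_left flip: sum_distrib_right)
  finally show ?case .
qed simp

lemma tensor_pow_vec_carrier [simp]: "tensor_pow_vec N v \<in> carrier_vec (2 ^ N)"
  by (simp add: tensor_pow_vec_def)

text \<open>The form factorizes over the parties: party \<open>k\<close> contributes the matrix
  element of \<open>A\<close>, and each of the other N - 1 parties contributes the overlap of
  \<open>v\<close> and \<open>w\<close>.\<close>

lemma sesq_local_op_tensor:
  assumes k: "k < N"
  shows "sesq (local_op N k A) (tensor_pow_vec N v) (tensor_pow_vec N w)
    = (\<Sum>a<2. \<Sum>b<2. cnj (v $ a) * A $$ (a, b) * w $ b) * (cnj (v $ 0) * w $ 0 + cnj (v $ 1) * w $ 1) ^ (N - 1)"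
proof -
  define g where "g l q = (if l = k then cnj (v $ q) * (\<Sum>b<2. A $$ (q, b) * w $ b) else cnj (v $ q) * w $ q)" for l q
  have entry: "cnj (tensor_pow_vec N v $ r) * (local_op N k A *\<^sub>v tensor_pow_vec N w) $ r = (\<Prod>l<N. g l (qbit l r))"
    if r: "r < 2 ^ N" for r
  proof -
    define R where "R = (\<Prod>l\<in>{..<N} - {k}. w $ qbit l r)"
    have split: "(\<Prod>l<N. f l) = f k * (\<Prod>l\<in>{..<N} - {k}. f l)" for f :: "nat \<Rightarrow> complex"
      using k by (simp add: prod.remove)
    have "tensor_pow_vec N w $ put_bit k b r = w $ b * R" if "b < 2" for b
      unfolding R_def using that k r
      by (simp add: tensor_pow_vec_def put_bit_less split qbit_put_bit)
    then have "(local_op N k A *\<^sub>v tensor_pow_vec N w) $ r = (\<Sum>b<2. A $$ (qbit k r, b) * (w $ b * R))"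
      by (subst local_op_mult_vec[OF k tensor_pow_vec_carrier r]) simp
    also have "\<dots> = (\<Sum>b<2. A $$ (qbit k r, b) * w $ b) * R"
      by (simp add: sum_distrib_right mult.assoc)
    finally show ?thesis using r
      by (simp add: tensor_pow_vec_def split R_def g_def prod.distrib cnj_prod mult_ac)
  qed
  have "sesq (local_op N k A) (tensor_pow_vec N v) (tensor_pow_vec N w)
      = (\<Sum>r<2 ^ N. cnj (tensor_pow_vec N v $ r) * (local_op N k A *\<^sub>v tensor_pow_vec N w) $ r)"
    unfolding sesq_def by (simp add: scalar_prod_def atLeast0LessThan local_op_def tensor_pow_vec_def)
  also have "\<dots> = (\<Prod>l<N. g l 0 + g l 1)"
    unfolding sum_prod_qbit[symmetric] by (intro sum.cong refl entry) simp
  also have "\<dots> = (g k 0 + g k 1) * (\<Prod>l\<in>{..<N} - {k}. g l 0 + g l 1)"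
    using k by (simp add: prod.remove)
  also have "(\<Prod>l\<in>{..<N} - {k}. g l 0 + g l 1) = (cnj (v $ 0) * w $ 0 + cnj (v $ 1) * w $ 1) ^ (N - 1)"
    using k by (simp add: g_def)
  also have "g k 0 + g k 1 = (\<Sum>a<2. \<Sum>b<2. cnj (v $ a) * A $$ (a, b) * w $ b)"
    by (simp add: g_def numeral_2_eq_2 algebra_simps)
  finally show ?thesis .
qed

text \<open>Real unit vectors at angles 0, 240 and 120 degrees, in this order: up to its phase,
  \<open>Umat\<close> is minus the rotation by 60 degrees, that is, the rotation by 240
  degrees.\<close>

definition trine :: "nat \<Rightarrow> complex vec" where
  "trine i = vec_of_list (if i = 0 then [1, 0]
     else [-1/2, of_real (if i = 1 then - sqrt 3 / 2 else sqrt 3 / 2)])"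

lemma trine_dot:
  assumes "i < 3" "j < 3"
  shows "cnj (trine i $ 0) * trine j $ 0 + cnj (trine i $ 1) * trine j $ 1 = (if i = j then 1 else - 1/2)"
proof -
  have "complex_of_real (sqrt 3) * complex_of_real (sqrt 3) = 3"
    by (simp flip: of_real_mult)
  then show ?thesis
    using assms by (auto dest!: less_3_cases simp: trine_def field_simps)
qed

lemma Umat_power:
  assumes "i < 3"
  shows "(Umat N ^\<^sub>m i) *\<^sub>v ket0 = cis (2 * pi * i / N) \<cdot>\<^sub>v trine i"
proof -
  define z where "z = cis (2 * pi / N)"
  have s: "complex_of_real (sqrt 3) * complex_of_real (sqrt 3) = 3"
    by (simp flip: of_real_mult)
  have U: "Umat N = mat_of_rows_list 2 [[- z / 2, z * of_real (sqrt 3) / 2], [- z * of_real (sqrt 3) / 2, - z / 2]]"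
    by (rule eq_matI) (auto simp: Umat_def z_def mat_of_rows_list_def less_Suc_eq less_2_cases_iff)
  have Ucar: "Umat N \<in> carrier_mat 2 2" by (simp add: U mat_of_rows_list_def numeral_2_eq_2)
  have kcar: "ket0 \<in> carrier_vec 2" by (simp add: ket0_def carrier_vecI)
  have step: "Umat N *\<^sub>v vec_of_list [x, y] = vec_of_list [- z / 2 * x + z * of_real (sqrt 3) / 2 * y,
      - z * of_real (sqrt 3) / 2 * x - z / 2 * y]" for x y
    by (rule eq_vecI) (auto simp: U mat_of_rows_list_def scalar_prod_def less_Suc_eq less_2_cases_iff numeral_2_eq_2)
  have U1: "Umat N *\<^sub>v ket0 = z \<cdot>\<^sub>v trine 1"
    unfolding ket0_def step by (auto intro!: eq_vecI simp: trine_def less_Suc_eq)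
  have trine1: "z \<cdot>\<^sub>v trine 1 = vec_of_list [- z / 2, - z * of_real (sqrt 3) / 2]"
    by (auto intro!: eq_vecI simp: trine_def less_Suc_eq)
  have U2: "Umat N *\<^sub>v (z \<cdot>\<^sub>v trine 1) = (z * z) \<cdot>\<^sub>v trine 2"
    unfolding trine1 step using s by (auto intro!: eq_vecI simp: trine_def less_Suc_eq field_simps)
  have zz: "cis (2 * pi * 2 / N) = z * z" by (simp add: z_def cis_mult)
  from less_3_cases[OF assms] show ?thesis
  proof (elim disjE)
    assume i: "i = 0"
    show ?thesis using Ucar kcar unfolding i by (simp add: trine_def ket0_def)
  next
    assume i: "i = 1"
    show ?thesis using Ucar U1 unfolding i by (simp add: z_def)
  next
    assume i: "i = 2"
    have "(Umat N ^\<^sub>m 2) *\<^sub>v ket0 = Umat N *\<^sub>v (Umat N *\<^sub>v ket0)"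
      using Ucar kcar by (simp add: numeral_2_eq_2 assoc_mult_mat_vec[of _ 2 2 _ 2])
    then show ?thesis unfolding i U1 U2 zz[symmetric] by simp
  qed
qed

text \<open>The phases \<open>cis (2 * pi * i / N)\<close> of the single-qubit states disappear in the \<open>N\<close>-fold tensor power.\<close>

lemma psi_eq_trine:
  assumes "0 < N" "i < 3"
  shows "psi N i = tensor_pow_vec N (trine i)"
proof (rule eq_vecI)
  fix j assume "j < dim_vec (tensor_pow_vec N (trine i))"
  then have j: "j < 2 ^ N" by (simp add: tensor_pow_vec_def)
  have dim: "dim_vec (trine i) = 2" by (simp add: trine_def)
  have "(\<Prod>l<N. (cis (2 * pi * i / N) \<cdot>\<^sub>v trine i) $ qbit l j) = cis (2 * pi * i / N) ^ N * (\<Prod>l<N. trine i $ qbit l j)"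
    by (simp add: dim prod.distrib)
  also have "cis (2 * pi * i / N) ^ N = 1"
    using assms(1) cis_multiple_2pi[of "real i"] unfolding DeMoivre by simp
  finally show "psi N i $ j = tensor_pow_vec N (trine i) $ j"
    using j by (simp add: psi_def tensor_pow_vec_def Umat_power[OF assms(2)])
qed (simp add: psi_def tensor_pow_vec_def)

lemma sesq_one_psi:
  assumes "0 < N" "i < 3" "j < 3"
  shows "sesq (1\<^sub>m (2 ^ N)) (psi N i) (psi N j) = (if i = j then 1 else of_real ((- 1/2) ^ N))"
proof -
  \<comment> \<open>The overlap is computed as the form of the identity acting on qubit 0, so that
    \<open>sesq_local_op_tensor\<close> covers it.\<close>
  have "(1 :: complex) \<cdot>\<^sub>m 1\<^sub>m 2 = 1\<^sub>m 2" by (rule eq_matI) auto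
  then have "local_op N 0 (1\<^sub>m 2) *\<^sub>v tensor_pow_vec N (trine j) = tensor_pow_vec N (trine j)"
    using local_op_scalar[OF assms(1) tensor_pow_vec_carrier, of 1 "trine j"] by simp
  then have "sesq (1\<^sub>m (2 ^ N)) (psi N i) (psi N j) = sesq (local_op N 0 (1\<^sub>m 2)) (tensor_pow_vec N (trine i)) (tensor_pow_vec N (trine j))"
    using assms by (simp add: psi_eq_trine sesq_def one_mult_mat_vec[OF tensor_pow_vec_carrier])
  also have "\<dots> = (cnj (trine i $ 0) * trine j $ 0 + cnj (trine i $ 1) * trine j $ 1) ^ N"
    unfolding sesq_local_op_tensor[OF assms(1)] using assms(1)
    by (cases N) (simp_all add: numeral_2_eq_2)
  finally show ?thesis unfolding trine_dot[OF assms(2,3)] by simp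
qed

text \<open>Here p, q, r, s are the entries of a one-qubit operator E, h is half the square root of
  3, and d is the overlap factor of the other parties. The hypotheses are entries of the equation
  between the form of E on the \<psi> i and S D S. Diagonal and off-diagonal entries give two
  relations between the differences of the D i and the non-scalar part of E; \<open>nz\<close> says
  that the two relations are independent.\<close>

lemma diagonal_form_trivial:
  fixes p q r s D0 D1 D2 a b d h :: complex
  assumes h: "4 * h * h = 3" and d: "d \<noteq> 0" and nz: "d * (a\<^sup>2 + 2 * a * b) + a * b \<noteq> 0"
    and m00: "p = (a + b)\<^sup>2 * D0 + b\<^sup>2 * (D1 + D2)"
    and m11: "p + 2 * h * (q + r) + 3 * s = 4 * ((a + b)\<^sup>2 * D1 + b\<^sup>2 * (D0 + D2))"
    and m22: "p - 2 * h * (q + r) + 3 * s = 4 * ((a + b)\<^sup>2 * D2 + b\<^sup>2 * (D0 + D1))"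
    and m01: "d * (p + 2 * h * q) = - 2 * ((a + b) * b * (D0 + D1) + b\<^sup>2 * D2)"
    and m10: "d * (p + 2 * h * r) = - 2 * ((a + b) * b * (D0 + D1) + b\<^sup>2 * D2)"
    and m02: "d * (p - 2 * h * q) = - 2 * ((a + b) * b * (D0 + D2) + b\<^sup>2 * D1)"
    and m12: "d * (p - 2 * h * q + 2 * h * r - 3 * s) = 4 * ((a + b) * b * (D1 + D2) + b\<^sup>2 * D0)"
  shows "q = 0" "r = 0" "p = s"
proof -
  have h0: "h \<noteq> 0" using h by auto
  define X where "X = a\<^sup>2 + 2 * a * b"
  have "d * (p + 2 * h * q) = d * (p + 2 * h * r)" using m01 m10 by simp
  then have qr: "r = q" using d h0 by simp
  have "8 * (h * q) = (p + 2 * h * (q + r) + 3 * s) - (p - 2 * h * (q + r) + 3 * s)"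
    by (simp add: qr algebra_simps)
  also have "\<dots> = 4 * (X * (D1 - D2))"
    unfolding m11 m22 X_def by (simp add: power2_eq_square algebra_simps)
  finally have 1: "2 * (h * q) = X * (D1 - D2)" by simp
  have "4 * (d * (h * q)) = d * (p + 2 * h * q) - d * (p - 2 * h * q)"
    by (simp add: algebra_simps)
  also have "\<dots> = - 2 * (a * b * (D1 - D2))"
    unfolding m01 m02 by (simp add: power2_eq_square algebra_simps)
  finally have "2 * (d * (2 * (h * q)) + a * b * (D1 - D2)) = 0" by (simp add: algebra_simps)
  then have 2: "d * (2 * (h * q)) + a * b * (D1 - D2) = 0" unfolding mult_eq_0_iff by simp
  \<comment> \<open>Eliminates h q between the diagonal and the off-diagonal relation.\<close>
  have "(d * X + a * b) * (D1 - D2) = 0"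
    using 2 unfolding 1 by (simp add: algebra_simps)
  then have D12: "D2 = D1" using nz by (simp add: X_def)
  then show q: "q = 0" using 1 h0 by simp
  then show "r = 0" using qr by simp
  \<comment> \<open>The same elimination, now with p - s in place of h q and D0 - D1 in place of D1
    - D2.\<close>
  have "3 * (p - s) = 4 * p - (p + 2 * h * (q + r) + 3 * s)"
    by (simp add: qr q)
  also have "\<dots> = 4 * (X * (D0 - D1))"
    unfolding m11 unfolding m00 X_def D12 by (simp add: power2_eq_square algebra_simps)
  finally have 3: "3 * (p - s) = 4 * (X * (D0 - D1))" .
  have "d * (3 * (p - s)) = d * (p - 2 * h * q + 2 * h * r - 3 * s) + 2 * (d * (p + 2 * h * q))"
    by (simp add: qr q algebra_simps)
  also have "\<dots> = - 4 * (a * b * (D0 - D1))"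
    unfolding m01 m12 D12 by (simp add: power2_eq_square algebra_simps)
  finally have "4 * ((d * X + a * b) * (D0 - D1)) = 0"
    unfolding 3 by (simp add: algebra_simps)
  then have "D0 = D1" using nz by (simp add: X_def)
  then show "p = s" using 3 by simp
qed

section \<open>The square root of the Gram matrix and the orthonormal frame\<close>

context
  fixes N :: nat
  assumes N: "N \<ge> 2"
begin

definition gram :: real where "gram = (- 1/2) ^ N"

text \<open>With J the all-ones 3x3 matrix, the Gram matrix (1 - \<open>gram\<close>) I +
  \<open>gram\<close> J has eigenvalues 1 - \<open>gram\<close> and 1 + 2 \<open>gram\<close>. Its
  positive square root is a I + b J, where a and a + 3b are the square roots of these
  eigenvalues.\<close>

definition root_a :: real where "root_a = sqrt (1 - gram)"

definition root_b :: real where "root_b = (sqrt (1 + 2 * gram) - root_a) / 3"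

text \<open>The extreme values are 1/4 at N = 2 and -1/8 at N = 3, since a negative overlap requires
  odd N. The lower bound keeps 1 + 2 \<open>gram\<close> positive.\<close>

lemma gram_bounds: "gram \<noteq> 0" "\<bar>gram\<bar> \<le> 1/4" "gram \<ge> - 1/8"
proof -
  show "gram \<noteq> 0" by (simp add: gram_def)
  have abs: "\<bar>gram\<bar> = (1/2) ^ N" by (simp add: gram_def power_abs)
  show "\<bar>gram\<bar> \<le> 1/4"
    using power_decreasing[OF N, of "1/2 :: real"] by (simp add: abs power2_eq_square)
  show "gram \<ge> - 1/8"
  proof (cases "even N")
    case True
    then have "0 \<le> gram" by (simp add: gram_def)
    then show ?thesis by simp
  next
    case False
    then have "3 \<le> N" using N by (cases "N = 2") auto
    from power_decreasing[OF this, of "1/2 :: real"] have "\<bar>gram\<bar> \<le> 1/8"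
      by (simp add: abs power3_eq_cube)
    then show ?thesis by simp
  qed
qed

lemma root_facts:
  shows "root_a > 0" "root_a + 3 * root_b > 0" "root_a\<^sup>2 = 1 - gram"
    "2 * root_a * root_b + 3 * root_b\<^sup>2 = gram" "root_b \<noteq> 0" "root_b\<^sup>2 \<le> 1/16"
proof -
  show a: "root_a > 0" and a2: "root_a\<^sup>2 = 1 - gram"
    using gram_bounds by (auto simp: root_a_def)
  have sqrt: "root_a + 3 * root_b = sqrt (1 + 2 * gram)"
    by (simp add: root_b_def diff_divide_distrib)
  have ab2: "(root_a + 3 * root_b)\<^sup>2 = 1 + 2 * gram"
    using gram_bounds by (simp add: sqrt)
  show ab: "root_a + 3 * root_b > 0"
    using gram_bounds by (simp add: sqrt)
  show g: "2 * root_a * root_b + 3 * root_b\<^sup>2 = gram"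
    using a2 ab2 by (simp add: power2_eq_square algebra_simps)
  then show "root_b \<noteq> 0" using gram_bounds by auto
  \<comment> \<open>Both eigenvalues are at least 3/4, hence at least 9/16. So 2a + 3b is at least
    1, and \<open>gram\<close> = b (2a + 3b) bounds b.\<close>
  have "(3/4)\<^sup>2 \<le> root_a\<^sup>2" "(3/4)\<^sup>2 \<le> (root_a + 3 * root_b)\<^sup>2"
    unfolding a2 ab2 using gram_bounds by (simp_all add: power2_eq_square)
  then have "3/4 \<le> root_a" "3/4 \<le> root_a + 3 * root_b"
    using a ab by (auto intro: power2_le_imp_le)
  then have "1 \<le> \<bar>2 * root_a + 3 * root_b\<bar>" by linarith
  then have "\<bar>root_b\<bar> \<le> \<bar>root_b\<bar> * \<bar>2 * root_a + 3 * root_b\<bar>"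
    by (simp add: mult_le_cancel_left1)
  also have "\<dots> = \<bar>gram\<bar>"
    unfolding g[symmetric] abs_mult[symmetric] by (simp add: power2_eq_square algebra_simps)
  also have "\<dots> \<le> 1/4" by (rule gram_bounds)
  finally show "root_b\<^sup>2 \<le> 1/16"
    using power_mono[of "\<bar>root_b\<bar>" "1/4" 2] by (simp add: power2_eq_square)
qed

text \<open>The expression factors as -3ab (1 + 2ab). The last factor is positive because 2ab =
  \<open>gram\<close> - 3b^2 is at least -1/8 - 3/16.\<close>

lemma rigidity_constant:
  "(- 1/2) ^ (N - 1) * (root_a\<^sup>2 + 2 * root_a * root_b) + root_a * root_b \<noteq> 0"
proof -
  let ?a = root_a and ?b = root_b
  have d: "(- 1/2) ^ (N - 1) = - 2 * gram"
    using N by (simp add: gram_def power_eq_if)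
  have "- 2 * gram * (?a\<^sup>2 + 2 * ?a * ?b) + ?a * ?b
      = - 2 * (2 * ?a * ?b + 3 * ?b\<^sup>2) * (1 - gram + 2 * ?a * ?b) + ?a * ?b"
    by (simp only: root_facts(3,4))
  also have "1 - gram + 2 * ?a * ?b = 1 - 3 * ?b\<^sup>2"
    using root_facts(4) by simp
  also have "- 2 * (2 * ?a * ?b + 3 * ?b\<^sup>2) * (1 - 3 * ?b\<^sup>2) + ?a * ?b
      = - 3 * ?b * (?a + 2 * ?b * (1 - (2 * ?a * ?b + 3 * ?b\<^sup>2)))"
    by (simp add: power2_eq_square algebra_simps)
  \<comment> \<open>The inner bracket is 1 - \<open>gram\<close>, which is a^2; this is what makes
    the expression factor.\<close>
  also have "\<dots> = - 3 * ?b * (?a + 2 * ?b * (?a * ?a))"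
    using root_facts(3) by (simp only: root_facts(4)) (simp add: power2_eq_square)
  also have "\<dots> = - 3 * ?b * ?a * (1 + 2 * ?a * ?b)"
    by (simp add: algebra_simps)
  finally have "- 2 * gram * (?a\<^sup>2 + 2 * ?a * ?b) + ?a * ?b = - 3 * ?b * ?a * (1 + 2 * ?a * ?b)" .
  moreover have "1 + 2 * ?a * ?b > 0"
    using root_facts(4,6) gram_bounds(3) by simp
  ultimately show ?thesis
    unfolding d using root_facts(1,5) by simp
qed

definition gram_root :: "nat \<Rightarrow> nat \<Rightarrow> real" where
  "gram_root i j = (if j = i then root_a else 0) + root_b"

text \<open>The inverse of a I + b J by the Sherman-Morrison formula.\<close>

definition gram_root_inv :: "nat \<Rightarrow> nat \<Rightarrow> real" where
  "gram_root_inv i j = ((if j = i then 1 else 0) - root_b / (root_a + 3 * root_b)) / root_a"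

lemma gram_root_inverse:
  assumes "i < 3" "l < 3"
  shows "(\<Sum>j<3. gram_root i j * gram_root_inv j l) = (if i = l then 1 else 0)"
proof -
  define \<gamma> where "\<gamma> = root_b / (root_a + 3 * root_b)"
  have "\<gamma> * (root_a + 3 * root_b) = root_b" using root_facts(2) by (simp add: \<gamma>_def)
  \<comment> \<open>Oriented as a rewrite rule that removes every product of \<open>\<gamma>\<close>
    and \<open>root_a\<close>.\<close>
  then have \<gamma>: "\<gamma> * root_a = root_b - 3 * (\<gamma> * root_b)" by (simp add: algebra_simps)
  show ?thesis
    using assms root_facts(1) unfolding gram_root_def gram_root_inv_def \<gamma>_def[symmetric]
    by (auto dest!: less_3_cases simp: lessThan_3 divide_simps) (simp_all add: algebra_simps \<gamma>)
qed

lemma gram_root_square: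
  assumes "l < 3" "m < 3"
  shows "(\<Sum>k<3. gram_root l k * gram_root k m) = (if l = m then 1 else gram)"
  using assms root_facts(3) unfolding root_facts(4)[symmetric] gram_root_def
  by (auto dest!: less_3_cases simp: lessThan_3 power2_eq_square algebra_simps)

lemma gram_root_sym: "gram_root i j = gram_root j i" "gram_root_inv i j = gram_root_inv j i"
  by (simp_all add: gram_root_def gram_root_inv_def)

text \<open>Symmetric (Loewdin) orthogonalization of the states: the inverse root of the Gram matrix
  applied to them.\<close>

definition frame :: "nat \<Rightarrow> complex vec" where
  "frame j = vcomb (2 ^ N) {..<3} (\<lambda>i. of_real (gram_root_inv j i)) (psi N)"

lemma psi_dim [simp]: "psi N i \<in> carrier_vec (2 ^ N)"
  by (simp add: psi_def)

lemma symmetric_triple_frame: "symmetric_triple (2 ^ N) frame (psi N) root_a root_b"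
proof
  show "frame i \<in> carrier_vec (2 ^ N)" for i by (simp add: frame_def)
  show "0 < root_a" "0 < root_a + 3 * root_b" using root_facts by simp_all
  show "(root_a + root_b)\<^sup>2 + 2 * root_b\<^sup>2 = 1"
    using root_facts(3,4) by (simp add: power2_eq_square algebra_simps)
  have pN: "0 < N" using N by simp
  show "psi N i = vcomb (2 ^ N) {..<3} (\<lambda>j. of_real ((if j = i then root_a else 0) + root_b)) frame" if i: "i < 3" for i
  proof (rule eq_vecI)
    fix r assume "r < dim_vec (vcomb (2 ^ N) {..<3} (\<lambda>j. of_real ((if j = i then root_a else 0) + root_b)) frame)"
    then have r: "r < 2 ^ N" by (simp add: vcomb_def)
    have "vcomb (2 ^ N) {..<3} (\<lambda>j. of_real (gram_root i j)) frame $ r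
        = (\<Sum>j<3. \<Sum>l<3. of_real (gram_root i j * gram_root_inv j l) * psi N l $ r)"
      using r by (simp add: vcomb_def frame_def sum_distrib_left mult.assoc)
    also have "\<dots> = (\<Sum>l<3. of_real (\<Sum>j<3. gram_root i j * gram_root_inv j l) * psi N l $ r)"
      by (subst sum.swap) (simp add: sum_distrib_right)
    also have "\<dots> = (\<Sum>l<3. (if i = l then 1 else 0) * psi N l $ r)"
      by (intro sum.cong refl, subst gram_root_inverse) (use i in auto)
    also have "\<dots> = psi N i $ r"
      using i by (simp add: if_distrib[where f = "\<lambda>x. x * _"] cong: if_cong)
    finally show "psi N i $ r = vcomb (2 ^ N) {..<3} (\<lambda>j. of_real ((if j = i then root_a else 0) + root_b)) frame $ r"
      by (simp add: gram_root_def)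
  qed (simp_all add: vcomb_def psi_def tensor_pow_vec_def)
  show "sesq (1\<^sub>m (2 ^ N)) (frame i) (frame j) = (if i = j then 1 else 0)" if ij: "i < 3" "j < 3" for i j
  proof -
    let ?S = gram_root and ?T = gram_root_inv
    have "sesq (1\<^sub>m (2 ^ N)) (frame i) (frame j)
        = (\<Sum>l<3. \<Sum>m<3. of_real (?T i l) * of_real (?T j m) * sesq (1\<^sub>m (2 ^ N)) (psi N l) (psi N m))"
      unfolding frame_def by (subst sesq_vcomb) simp_all
    \<comment> \<open>The overlaps are the entries of S^2, so with T the inverse of S the sum is an
      entry of T S S T, regrouped below as products of S T with itself.\<close>
    also have "\<dots> = of_real (\<Sum>l<3. \<Sum>m<3. ?T i l * ?T j m * (\<Sum>k<3. ?S l k * ?S k m))"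
      unfolding of_real_sum of_real_mult
      by (intro sum.cong refl arg_cong2[where f = "(*)"])
        (simp add: sesq_one_psi[OF pN] gram_root_square gram_def flip: of_real_mult of_real_sum)
    also have "(\<Sum>l<3. \<Sum>m<3. ?T i l * ?T j m * (\<Sum>k<3. ?S l k * ?S k m))
        = (\<Sum>l<3. \<Sum>m<3. \<Sum>k<3. (?S k l * ?T l i) * (?S k m * ?T m j))"
      unfolding sum_distrib_left
    proof (intro sum.cong refl)
      fix l m k
      show "?T i l * ?T j m * (?S l k * ?S k m) = (?S k l * ?T l i) * (?S k m * ?T m j)"
        unfolding gram_root_sym(1)[of l k] gram_root_sym(2)[of i l] gram_root_sym(2)[of j m] by simp
    qed
    also have "\<dots> = (\<Sum>l<3. \<Sum>k<3. \<Sum>m<3. (?S k l * ?T l i) * (?S k m * ?T m j))"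
      by (intro sum.cong refl sum.swap)
    also have "\<dots> = (\<Sum>k<3. \<Sum>l<3. \<Sum>m<3. (?S k l * ?T l i) * (?S k m * ?T m j))"
      by (rule sum.swap)
    also have "\<dots> = (\<Sum>k<3. (\<Sum>l<3. ?S k l * ?T l i) * (\<Sum>m<3. ?S k m * ?T m j))"
      by (simp only: sum_product)
    also have "\<dots> = (\<Sum>k<3. (if k = i then 1 else 0) * (if k = j then 1 else 0))"
      by (intro sum.cong refl arg_cong2[where f = "(*)"] gram_root_inverse) (use ij in auto)
    also have "\<dots> = (if i = j then 1 else 0)"
      using ij by (simp add: if_distrib[where f = "\<lambda>x. x * _"] cong: if_cong)
    finally show ?thesis by simp
  qed
qed

section \<open>Rigidity of the frame and the contradiction\<close>

interpretation symmetric_triple "2 ^ N" frame "psi N" root_a root_b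
  by (rule symmetric_triple_frame)

text \<open>The form of E on the states is computed twice, from the tensor structure
  (\<open>Lf\<close>) and from the diagonal form in the frame (\<open>Rf\<close>); comparing entries
  gives the linear system of \<open>diagonal_form_trivial\<close>.\<close>

lemma locally_rigid_frame: "locally_rigid N frame"
  unfolding locally_rigid_def
proof (intro allI ballI impI)
  fix k E assume k: "k < N" and E: "E \<in> carrier_mat 2 2"
    and orth: "\<forall>i<3. \<forall>j<3. i \<noteq> j \<longrightarrow> sesq (local_op N k E) (frame i) (frame j) = 0"
  define D where "D i = sesq (local_op N k E) (frame i) (frame i)" for i
  define d :: complex where "d = (- 1/2) ^ (N - 1)"
  define h :: complex where "h = of_real (sqrt 3) / 2"
  have h: "h * h = 3/4" by (simp add: h_def flip: of_real_mult)
  have pN: "0 < N" using N by simp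
  define Lf where "Lf i j = (\<Sum>x<2. \<Sum>y<2. cnj (trine i $ x) * E $$ (x, y) * trine j $ y) * (if i = j then 1 else d)" for i j
  define Rf where "Rf i j = (\<Sum>m<3. \<Sum>l<3. of_real ((if m = i then root_a else 0) + root_b) *
    of_real ((if l = j then root_a else 0) + root_b) * (if m = l then D m else 0))" for i j
  have form: "Lf i j = Rf i j" if ij: "i < 3" "j < 3" for i j
  proof -
    have "Lf i j = sesq (local_op N k E) (psi N i) (psi N j)"
      unfolding psi_eq_trine[OF pN ij(1)] psi_eq_trine[OF pN ij(2)] sesq_local_op_tensor[OF k] trine_dot[OF ij]
      by (simp add: d_def Lf_def)
    also have "\<dots> = Rf i j"
      unfolding sesq_psi[OF local_op_carrier ij] Rf_def
      by (intro sum.cong refl arg_cong2[where f = "(*)"]) (use orth in \<open>auto simp: D_def\<close>)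
    finally show ?thesis .
  qed
  have nz: "d * ((of_real root_a)\<^sup>2 + 2 * of_real root_a * of_real root_b) + of_real root_a * of_real root_b \<noteq> 0"
  proof -
    have "d * ((of_real root_a)\<^sup>2 + 2 * of_real root_a * of_real root_b) + of_real root_a * of_real root_b
      = of_real ((- 1/2) ^ (N - 1) * (root_a\<^sup>2 + 2 * root_a * root_b) + root_a * root_b)"
      by (simp add: d_def)
    then show ?thesis using rigidity_constant by (simp only: of_real_eq_0_iff not_False_eq_True)
  qed
  have d: "d \<noteq> 0" by (simp add: d_def)
  let ?a = "of_real root_a :: complex" and ?b = "of_real root_b :: complex"
  have t: "trine 0 $ 0 = 1" "trine 0 $ Suc 0 = 0" "trine (Suc 0) $ 0 = -1/2" "trine (Suc 0) $ Suc 0 = - h"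
    "trine 2 $ 0 = -1/2" "trine 2 $ Suc 0 = h"
    by (simp_all add: trine_def h_def)
  have ch: "cnj h = h" by (simp add: h_def)
  have two: "(\<Sum>x<2. f x) = f 0 + f 1" for f :: "nat \<Rightarrow> complex" by (simp add: numeral_2_eq_2)
  have hh: "h * (h * x) = 3 / 4 * x" for x using h by (simp flip: mult.assoc)
  have h4: "4 * h * h = 3" unfolding mult.assoc h by simp
  have "E $$ (0, 1) = 0 \<and> E $$ (1, 0) = 0 \<and> E $$ (0, 0) = E $$ (1, 1)"
  proof -
    obtain p q r s where eqs: "E $$ (0, 0) = p" "E $$ (0, Suc 0) = q" "E $$ (Suc 0, 0) = r" "E $$ (Suc 0, Suc 0) = s"
      by blast
    \<comment> \<open>The factors 1, 4 and -2 in these seven identities clear the denominators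
      coming from the entries -1/2 of the trine vectors.\<close>
    have m00: "p = (?a + ?b)\<^sup>2 * D 0 + ?b\<^sup>2 * (D 1 + D 2)"
    proof -
      have "p = 1 * Lf 0 0"
        by (simp add: Lf_def two t ch eqs hh field_simps)
      also have "\<dots> = (?a + ?b)\<^sup>2 * D 0 + ?b\<^sup>2 * (D 1 + D 2)"
        by (simp add: form, simp add: Rf_def lessThan_3 power2_eq_square algebra_simps)
      finally show ?thesis .
    qed
    have m11: "p + 2 * h * (q + r) + 3 * s = 4 * ((?a + ?b)\<^sup>2 * D 1 + ?b\<^sup>2 * (D 0 + D 2))"
    proof -
      have "p + 2 * h * (q + r) + 3 * s = 4 * Lf 1 1"
        by (simp add: Lf_def two t ch eqs hh field_simps)
      also have "\<dots> = 4 * ((?a + ?b)\<^sup>2 * D 1 + ?b\<^sup>2 * (D 0 + D 2))"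
        by (simp add: form, simp add: Rf_def lessThan_3 power2_eq_square algebra_simps)
      finally show ?thesis .
    qed
    have m22: "p - 2 * h * (q + r) + 3 * s = 4 * ((?a + ?b)\<^sup>2 * D 2 + ?b\<^sup>2 * (D 0 + D 1))"
    proof -
      have "p - 2 * h * (q + r) + 3 * s = 4 * Lf 2 2"
        by (simp add: Lf_def two t ch eqs hh field_simps)
      also have "\<dots> = 4 * ((?a + ?b)\<^sup>2 * D 2 + ?b\<^sup>2 * (D 0 + D 1))"
        by (simp add: form, simp add: Rf_def lessThan_3 power2_eq_square algebra_simps)
      finally show ?thesis .
    qed
    have m01: "d * (p + 2 * h * q) = - 2 * ((?a + ?b) * ?b * (D 0 + D 1) + ?b\<^sup>2 * D 2)"
    proof -
      have "d * (p + 2 * h * q) = - 2 * Lf 0 1"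
        by (simp add: Lf_def two t ch eqs hh field_simps)
      also have "\<dots> = - 2 * ((?a + ?b) * ?b * (D 0 + D 1) + ?b\<^sup>2 * D 2)"
        by (simp add: form, simp add: Rf_def lessThan_3 power2_eq_square algebra_simps)
      finally show ?thesis .
    qed
    have m10: "d * (p + 2 * h * r) = - 2 * ((?a + ?b) * ?b * (D 0 + D 1) + ?b\<^sup>2 * D 2)"
    proof -
      have "d * (p + 2 * h * r) = - 2 * Lf 1 0"
        by (simp add: Lf_def two t ch eqs hh field_simps)
      also have "\<dots> = - 2 * ((?a + ?b) * ?b * (D 0 + D 1) + ?b\<^sup>2 * D 2)"
        by (simp add: form, simp add: Rf_def lessThan_3 power2_eq_square algebra_simps)
      finally show ?thesis .
    qed
    have m02: "d * (p - 2 * h * q) = - 2 * ((?a + ?b) * ?b * (D 0 + D 2) + ?b\<^sup>2 * D 1)"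
    proof -
      have "d * (p - 2 * h * q) = - 2 * Lf 0 2"
        by (simp add: Lf_def two t ch eqs hh field_simps)
      also have "\<dots> = - 2 * ((?a + ?b) * ?b * (D 0 + D 2) + ?b\<^sup>2 * D 1)"
        by (simp add: form, simp add: Rf_def lessThan_3 power2_eq_square algebra_simps)
      finally show ?thesis .
    qed
    have m12: "d * (p - 2 * h * q + 2 * h * r - 3 * s) = 4 * ((?a + ?b) * ?b * (D 1 + D 2) + ?b\<^sup>2 * D 0)"
    proof -
      have "d * (p - 2 * h * q + 2 * h * r - 3 * s) = 4 * Lf 1 2"
        by (simp add: Lf_def two t ch eqs hh field_simps)
      also have "\<dots> = 4 * ((?a + ?b) * ?b * (D 1 + D 2) + ?b\<^sup>2 * D 0)"
        by (simp add: form, simp add: Rf_def lessThan_3 power2_eq_square algebra_simps)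
      finally show ?thesis .
    qed
    show ?thesis
      using diagonal_form_trivial[OF h4 d nz m00 m11 m22 m01 m10 m02 m12] by (simp add: eqs)
  qed
  then have "E $$ (0, 1) = 0" "E $$ (1, 0) = 0" "E $$ (0, 0) = E $$ (1, 1)" by simp_all
  then have "E = E $$ (0, 0) \<cdot>\<^sub>m 1\<^sub>m 2"
    using E by (intro eq_matI) (auto simp: less_2_cases_iff)
  then show "\<exists>c. E = c \<cdot>\<^sub>m 1\<^sub>m 2" by blast
qed

text \<open>Optimality would make the protocol discriminate the frame without error, which rigidity
  excludes.\<close>

lemma no_locc_optimal:
  assumes "is_locc_povm N P"
  shows "success_prob (\<lambda>_. 1/3) (psi N) P \<noteq> opt_success (2 ^ N) (\<lambda>_. 1/3) (psi N)"
proof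
  assume opt: "success_prob (\<lambda>_. 1/3) (psi N) P = opt_success (2 ^ N) (\<lambda>_. 1/3) (psi N)"
  obtain T where T: "locc_valid N T" and P: "\<And>i. i < 3 \<Longrightarrow> P i = locc_povm N T i"
    using assms by (auto simp: is_locc_povm_def)
  have "success_prob (\<lambda>_. 1/3) (psi N) P = weight (locc_povm N T) / 3"
    by (simp add: success_prob_def weight_def sesq_def sum_divide_distrib P)
  then have weight: "weight (locc_povm N T) \<ge> 3 * (root_a + root_b)\<^sup>2"
    using opt opt_success_ge by simp
  have "Re (sesq (locc_povm N T i) (frame j) (frame j)) = 0" if "i < 3" "j < 3" "i \<noteq> j" for i j
    by (rule optimal_discriminates[OF locc_povm_psd locc_povm_complete[OF T] weight that])
  then show False
    using locally_rigid_not_locc_discriminable[OF T locally_rigid_frame] e_carrier e_orthonormal by force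
qed

end

theorem theorem3:
  fixes N :: nat
  assumes "N \<ge> 2"
  shows "\<forall>P. is_locc_povm N P \<longrightarrow>
           success_prob (\<lambda>_. 1/3) (psi N) P \<noteq> opt_success (2 ^ N) (\<lambda>_. 1/3) (psi N)"
  using no_locc_optimal[OF assms] by blast

end
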